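(* Let $\mathcal W$ and $\mathcal U$ be universal Martin-Löf tests, and let $\mathcal A\subseteq 2^\omega$ be $\mathcal W$-layerwise semi-decidable. Then $\chi_{\mathcal A}\restriction\mathrm{MLR}\le_{\mathrm W}\mathsf{LAY}_{\mathcal U}$.
   Context: Cantor space $2^\omega$, Lebesgue measure $\lambda$. A sequence $(\mathcal U_i)_i$ of open subsets of $2^\omega$ is uniformly effectively open if $\{\langle i,\sigma\rangle:[\sigma]\subseteq\mathcal U_i\}$ is c.e. A Martin-Löf (ML) test is a uniformly effectively open sequence $(\mathcal V_i)_{i\in\omega}$ with $\lambda(\mathcal V_i)\le 2^{-i}$; it is universal if $\bigcap_i\mathcal V'_i\subseteq\bigcap_i\mathcal V_i$ for every ML-test $\mathcal V'$. $\mathrm{MLR}$ is the set of Martin-Löf random sequences. For universal $\mathcal W$, a set $\mathcal A\subseteq 2^\omega$ is $\mathcal W$-layerwise semi-decidable if there is a uniformly effectively open sequence $(\mathcal U'_i)_i$ with $\mathcal A\cap(2^\omega\setminus\mathcal W_i)=\mathcal U'_i\cap(2^\omega\setminus\mathcal W_i)$ for all $i$. $\chi_{\mathcal A}$ is the characteristic function, valued in $\{0,1\}\subseteq\omega$. A representation of a set $X$ is a surjective partial map $\delta_X:\subseteq\omega^\omega\to X$. A realizer of a multi-valued partial function $f:\subseteq X\rightrightarrows Y$ is a partial $\Gamma:\subseteq\omega^\omega\to\omega^\omega$ with $\delta_Y(\Gamma(p))\in f(\delta_X(p))$ for all $p\in\mathrm{dom}(f\circ\delta_X)$. $f\le_{\mathrm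 W} g$ if there are Turing functionals $\Phi,\Psi$ such that $p\mapsto\Psi(\langle p,\Gamma(\Phi(p))\rangle)$ realizes $f$ for every realizer $\Gamma$ of $g$. $\mathrm{MLR}$ is represented by the identity on $\mathrm{MLR}\subseteq\omega^\omega$, $\omega$ by $\chi_{\{n\}}\mapsto n$. $\mathsf{LAY}_{\mathcal U}\colon\mathrm{MLR}\rightrightarrows\omega$, $\mathsf{LAY}_{\mathcal U}(X)=\{i:X\notin\mathcal U_i\}$. *)

theory Defs
  imports "HOL-Probability.Probability" "HOL-Library.Nat_Bijection"
begin

datatype rf = Zr | Sc | Pj nat | Orc | Cn rf "rf list" | Pr rf rf | Mn rf

inductive eval :: "(nat \<Rightarrow> nat) \<Rightarrow> rf \<Rightarrow> nat list \<Rightarrow> nat \<Rightarrow> bool" for f where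
  ev_zero: "eval f Zr xs 0"
| ev_succ: "eval f Sc (x # xs) (Suc x)"
| ev_proj: "i < length xs \<Longrightarrow> eval f (Pj i) xs (xs ! i)"
| ev_orc: "eval f Orc (x # xs) (f x)"
| ev_comp: "length ys = length gs \<Longrightarrow> (\<forall>i<length gs. eval f (gs ! i) xs (ys ! i))
             \<Longrightarrow> eval f h ys z \<Longrightarrow> eval f (Cn h gs) xs z"
| ev_pr0: "eval f g xs y \<Longrightarrow> eval f (Pr g h) (0 # xs) y"
| ev_prS: "eval f (Pr g h) (n # xs) y \<Longrightarrow> eval f h (n # y # xs) z
             \<Longrightarrow> eval f (Pr g h) (Suc n # xs) z"
| ev_mu: "eval f g (n # xs) 0 \<Longrightarrow> (\<forall>m<n. \<exists>v. v \<noteq> 0 \<and> eval f g (m # xs) v)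
             \<Longrightarrow> eval f (Mn g) xs n"

definition ce :: "nat set \<Rightarrow> bool" where
  "ce S \<longleftrightarrow> (\<exists>e. \<forall>n. n \<in> S \<longleftrightarrow> (\<exists>v. eval (\<lambda>_. 0) e [n] v))"

definition turing_functional :: "((nat \<Rightarrow> nat) \<Rightarrow> (nat \<Rightarrow> nat) option) \<Rightarrow> bool" where
  "turing_functional \<Phi> \<longleftrightarrow> (\<exists>e. \<forall>p. \<Phi> p =
      (if \<forall>n. \<exists>v. eval p e [n] v then Some (\<lambda>n. THE v. eval p e [n] v) else None))"

type_synonym cantor = "nat \<Rightarrow> bool"

definition cyl :: "bool list \<Rightarrow> cantor set" where
  "cyl \<sigma> = {X. \<forall>k<length \<sigma>. X k = \<sigma> ! k}"

definition cantor_open :: "cantor set \<Rightarrow> bool" where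
  "cantor_open U \<longleftrightarrow> (\<forall>X\<in>U. \<exists>\<sigma>. X \<in> cyl \<sigma> \<and> cyl \<sigma> \<subseteq> U)"

definition str_code :: "bool list \<Rightarrow> nat" where
  "str_code \<sigma> = list_encode (map of_bool \<sigma>)"

definition pair_code :: "nat \<Rightarrow> bool list \<Rightarrow> nat" where
  "pair_code i \<sigma> = prod_encode (i, str_code \<sigma>)"

definition unif_eff_open :: "(nat \<Rightarrow> cantor set) \<Rightarrow> bool" where
  "unif_eff_open U \<longleftrightarrow> (\<forall>i. cantor_open (U i)) \<and>
      ce {pair_code i \<sigma> | i \<sigma>. cyl \<sigma> \<subseteq> U i}"

definition lam :: "cantor measure" where
  "lam = PiM UNIV (\<lambda>_::nat. measure_pmf (bernoulli_pmf (1/2)))"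

definition mltest :: "(nat \<Rightarrow> cantor set) \<Rightarrow> bool" where
  "mltest V \<longleftrightarrow> unif_eff_open V \<and> (\<forall>i. emeasure lam (V i) \<le> ennreal ((1/2) ^ i))"

definition universal_mltest :: "(nat \<Rightarrow> cantor set) \<Rightarrow> bool" where
  "universal_mltest V \<longleftrightarrow> mltest V \<and>
      (\<forall>V'. mltest V' \<longrightarrow> (\<Inter>i. V' i) \<subseteq> (\<Inter>i. V i))"

definition MLR :: "cantor set" where
  "MLR = {X. \<forall>V. mltest V \<longrightarrow> X \<notin> (\<Inter>i. V i)}"

definition layerwise_semidec :: "(nat \<Rightarrow> cantor set) \<Rightarrow> cantor set \<Rightarrow> bool" where
  "layerwise_semidec W A \<longleftrightarrow> (\<exists>U'. unif_eff_open U' \<and>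
      (\<forall>i. A \<inter> (- W i) = U' i \<inter> (- W i)))"

text \<open>A representation is a partial map from Baire space; a multi-valued partial function
  f is given by its value sets, its domain being the points with nonempty value set.\<close>

definition realizes ::
  "((nat \<Rightarrow> nat) \<Rightarrow> 'a option) \<Rightarrow> ((nat \<Rightarrow> nat) \<Rightarrow> 'b option) \<Rightarrow> ('a \<Rightarrow> 'b set)
   \<Rightarrow> ((nat \<Rightarrow> nat) \<Rightarrow> (nat \<Rightarrow> nat) option) \<Rightarrow> bool" where
  "realizes \<delta>X \<delta>Y f \<Gamma> \<longleftrightarrow> (\<forall>p x. \<delta>X p = Some x \<longrightarrow> f x \<noteq> {} \<longrightarrow>
      (\<exists>q y. \<Gamma> p = Some q \<and> \<delta>Y q = Some y \<and> y \<in> f x))"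

definition pair_seq :: "(nat \<Rightarrow> nat) \<Rightarrow> (nat \<Rightarrow> nat) \<Rightarrow> nat \<Rightarrow> nat" where
  "pair_seq p q n = (if even n then p (n div 2) else q (n div 2))"

definition weihrauch_le ::
  "((nat \<Rightarrow> nat) \<Rightarrow> 'a option) \<Rightarrow> ((nat \<Rightarrow> nat) \<Rightarrow> 'b option) \<Rightarrow> ('a \<Rightarrow> 'b set)
   \<Rightarrow> ((nat \<Rightarrow> nat) \<Rightarrow> 'c option) \<Rightarrow> ((nat \<Rightarrow> nat) \<Rightarrow> 'd option) \<Rightarrow> ('c \<Rightarrow> 'd set) \<Rightarrow> bool" where
  "weihrauch_le \<delta>X \<delta>Y f \<delta>X' \<delta>Y' g \<longleftrightarrow> (\<exists>\<Phi> \<Psi>. turing_functional \<Phi> \<and> turing_functional \<Psi> \<and>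
      (\<forall>\<Gamma>. realizes \<delta>X' \<delta>Y' g \<Gamma> \<longrightarrow>
         realizes \<delta>X \<delta>Y f (\<lambda>p. Option.bind (\<Phi> p) (\<lambda>q. Option.bind (\<Gamma> q) (\<lambda>r. \<Psi> (pair_seq p r))))))"

definition delta_MLR :: "(nat \<Rightarrow> nat) \<Rightarrow> cantor option" where
  "delta_MLR p = (if (\<forall>n. p n \<le> 1) \<and> (\<lambda>n. p n = 1) \<in> MLR then Some (\<lambda>n. p n = 1) else None)"

definition delta_nat :: "(nat \<Rightarrow> nat) \<Rightarrow> nat option" where
  "delta_nat p = (if \<exists>n. p = (\<lambda>k. if k = n then 1 else 0)
                  then Some (THE n. p = (\<lambda>k. if k = n then 1 else 0)) else None)"

definition chi_MLR :: "cantor set \<Rightarrow> cantor \<Rightarrow> nat set" where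
  "chi_MLR A X = (if X \<in> MLR then {if X \<in> A then 1 else 0} else {})"

definition LAY :: "(nat \<Rightarrow> cantor set) \<Rightarrow> cantor \<Rightarrow> nat set" where
  "LAY U X = (if X \<in> MLR then {i. X \<notin> U i} else {})"

end

theory Submission
  imports Defs
begin

text \<open>
  For a random X let i be the least index with X outside W i. A guess for i, and with it a guess for
  "X is in A", is computed in stages and changes only finitely often. The forward functional outputs X
  itself, except that whenever a guess changes at stage s it writes zeros until the resulting prefix is
  seen to lie in U j for all j \<le> s. This happens after finitely many zeros, because a finite string
  followed by zeros is not random and U is universal. The output differs from X in finitely many places,
  so it is still random, and any j with the output outside U j exceeds every stage at which a guess
  changed. Hence the guess made for X at stage j is the correct answer.
\<close>

section \<open>Computable functionals\<close>

text \<open>A realizer of \<open>LAY U\<close> may return any admissible index, and no relation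
  between the layers of \<open>U\<close> and those of \<open>W\<close> is given. Applied to X
  itself, such an index would not bound the stage at which the guesses settle, so the input to
  \<open>LAY U\<close> is altered until every admissible index is such a bound. Since
  \<open>U\<close> is not assumed to be decreasing, a change at stage s has to push the output into
  each of U 0, ..., U s, not just into U s. The prefix present at stage s may already contain zeros
  written for earlier changes. The waiting condition therefore ranges over all strings of length s
  at once. It then depends neither on X nor on the output, and the output needs no recursion on
  itself. Both functionals must come from concrete \<open>rf\<close> programs. Closure rules for
  total functionals reduce this to following the syntax of the definitions; in the two functionals,
  the only unbounded search is the one that reads the returned index. C.e. sets enter through
  decidable stage approximations that are monotone in the stage.\<close>

inductive_cases eval_ZrE: "eval f Zr xs v"
inductive_cases eval_ScE: "eval f Sc xs v"
inductive_cases eval_PjE: "eval f (Pj i) xs v"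
inductive_cases eval_OrcE: "eval f Orc xs v"
inductive_cases eval_CnE: "eval f (Cn h gs) xs v"
inductive_cases eval_Pr0E: "eval f (Pr g h) (0 # xs) v"
inductive_cases eval_PrSE: "eval f (Pr g h) (Suc n # xs) v"
inductive_cases eval_MnE: "eval f (Mn g) xs v"

text \<open>Makes the \<open>THE\<close> in \<open>turing_functional\<close> denote the computed
  value. For \<open>Mn\<close>, two different results would clash at the smaller one, where one
  derivation gives 0 and the other a nonzero value.\<close>

lemma eval_deterministic: "eval f e xs v \<Longrightarrow> eval f e xs w \<Longrightarrow> w = v"
proof (induction arbitrary: w rule: eval.induct)
  case (ev_comp ys gs xs h z)
  from ev_comp.prems obtain ys' where ys': "length ys' = length gs"
    "\<forall>i<length gs. eval f (gs ! i) xs (ys' ! i)" "eval f h ys' w"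
    by (rule eval_CnE) metis
  have "ys' = ys"
    using ev_comp.hyps(1) ev_comp.IH(1) ys' by (intro nth_equalityI) auto
  then show ?case using ev_comp.IH(2) ys' by blast
next
  case (ev_prS g h n xs y z)
  from ev_prS.prems obtain y' where "eval f (Pr g h) (n # xs) y'" "eval f h (n # y' # xs) w"
    by (rule eval_PrSE)
  then show ?case using ev_prS.IH by blast
next
  case (ev_mu g n xs)
  from ev_mu.prems have w: "eval f g (w # xs) 0" "\<forall>m<w. \<exists>v. v \<noteq> 0 \<and> eval f g (m # xs) v"
    by - (erule eval_MnE, simp)+
  show ?case
  proof (cases w n rule: linorder_cases)
    case less
    then show ?thesis using ev_mu.IH(2) w(1) by blast
  next
    case greater
    then show ?thesis using ev_mu.IH(1) w(2) by blast
  qed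
next
  case ev_zero
  then show ?case by (rule eval_ZrE)
next
  case ev_succ
  then show ?case by (rule eval_ScE) simp
next
  case ev_proj
  from ev_proj.prems show ?case by (rule eval_PjE)
next
  case ev_orc
  then show ?case by (rule eval_OrcE) simp
next
  case ev_pr0
  from ev_pr0.prems show ?case by (rule eval_Pr0E) (rule ev_pr0.IH)
qed

text \<open>Functionals take an oracle f and an environment v, of which only the first k entries are
  visible to the program. Binders extend the environment at position 0, as with de Bruijn indices.\<close>

definition cfun :: "nat \<Rightarrow> ((nat \<Rightarrow> nat) \<Rightarrow> (nat \<Rightarrow> nat) \<Rightarrow> nat) \<Rightarrow> bool" where
  "cfun k F \<longleftrightarrow> (\<exists>e. \<forall>f v. eval f e (map v [0..<k]) (F f v))"

definition cpred :: "nat \<Rightarrow> ((nat \<Rightarrow> nat) \<Rightarrow> (nat \<Rightarrow> nat) \<Rightarrow> bool) \<Rightarrow> bool" where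
  "cpred k P \<longleftrightarrow> cfun k (\<lambda>f v. of_bool (P f v))"

section \<open>Closure rules for total computable functionals\<close>

named_theorems cintros

lemma cfun_var [cintros]: "i < k \<Longrightarrow> cfun k (\<lambda>f v. v i)"
  unfolding cfun_def
  by (rule exI[of _ "Pj i"]) (metis add_0 diff_zero ev_proj length_map length_upt nth_map_upt)

lemma cfun_comp:
  assumes "cfun m F" and "\<And>i. i < m \<Longrightarrow> cfun k (G i)"
  shows "cfun k (\<lambda>f v. F f (\<lambda>i. G i f v))"
proof -
  obtain h where h: "\<And>f v. eval f h (map v [0..<m]) (F f v)"
    using assms(1) by (auto simp: cfun_def)
  obtain gs where gs: "\<And>i f v. i < m \<Longrightarrow> eval f (gs i) (map v [0..<k]) (G i f v)"
    using assms(2) unfolding cfun_def by metis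
  have "eval f (Cn h (map gs [0..<m])) (map v [0..<k]) (F f (\<lambda>i. G i f v))" for f v
    by (rule ev_comp[where ys = "map (\<lambda>i. G i f v) [0..<m]"]) (auto intro: h gs)
  then show ?thesis by (auto simp: cfun_def)
qed

lemma cfun_comp1:
  assumes "cfun 1 (\<lambda>f v. F f (v 0))" and "cfun k A"
  shows "cfun k (\<lambda>f v. F f (A f v))"
  using cfun_comp[OF assms(1), of k "\<lambda>_. A"] assms(2) by simp

lemma cfun_comp2:
  assumes "cfun 2 (\<lambda>f v. F f (v 0) (v 1))" and "cfun k A" "cfun k B"
  shows "cfun k (\<lambda>f v. F f (A f v) (B f v))"
  using cfun_comp[OF assms(1), of k "\<lambda>i. if i = 0 then A else B"] assms(2,3) by simp

text \<open>The pattern \<open>F f (\<lambda>j. v (Suc j)) (v 0)\<close> separates the innermost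
  bound variable from the outer environment; this is simultaneous substitution for both. All binder
  rules below use the same pattern.\<close>

lemma cfun_subst:
  assumes "cfun (Suc k) (\<lambda>f v. F f (\<lambda>j. v (Suc j)) (v 0))"
    and "\<And>j. j < k \<Longrightarrow> cfun m (V j)" "cfun m A"
  shows "cfun m (\<lambda>f v. F f (\<lambda>j. V j f v) (A f v))"
proof -
  have "cfun m (case i of 0 \<Rightarrow> A | Suc j \<Rightarrow> V j)" if "i < Suc k" for i
    using assms(2,3) that by (auto split: nat.split)
  from cfun_comp[OF assms(1), of m "\<lambda>i. case i of 0 \<Rightarrow> A | Suc j \<Rightarrow> V j", OF this]
  show ?thesis by simp
qed

lemma cfun_Suc [cintros]:
  assumes "cfun k A" shows "cfun k (\<lambda>f v. Suc (A f v))"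
  by (rule cfun_comp1[OF _ assms]) (auto simp: cfun_def intro!: exI[of _ Sc] ev_succ)

lemma cfun_oracle [cintros]:
  assumes "cfun k A" shows "cfun k (\<lambda>f v. f (A f v))"
  by (rule cfun_comp1[OF _ assms]) (auto simp: cfun_def intro!: exI[of _ Orc] ev_orc)

lemma cfun_const [cintros]: "cfun k (\<lambda>f v. c)"
proof (induction c)
  case 0
  show ?case by (auto simp: cfun_def intro!: exI[of _ Zr] ev_zero)
qed (rule cfun_Suc)

lemma cfun_rec [cintros]:
  assumes "cfun k G" and "cfun (Suc (Suc k)) (\<lambda>f v. H f (\<lambda>j. v (Suc (Suc j))) (v 0) (v (Suc 0)))"
    and "cfun k N"
  shows "cfun k (\<lambda>f v. rec_nat (G f v) (H f v) (N f v))"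
proof -
  obtain g where g: "\<And>f v. eval f g (map v [0..<k]) (G f v)"
    using assms(1) by (auto simp: cfun_def)
  obtain h where h: "\<And>f v. eval f h (map v [0..<Suc (Suc k)])
      (H f (\<lambda>j. v (Suc (Suc j))) (v 0) (v (Suc 0)))"
    using assms(2) by (auto simp: cfun_def)
  have args: "map v [0..<Suc n] = v 0 # map (\<lambda>j. v (Suc j)) [0..<n]" for v :: "nat \<Rightarrow> nat" and n
    by (simp add: map_upt_Suc del: upt_Suc)
  have "eval f (Pr g h) (n # map v [0..<k]) (rec_nat (G f v) (H f v) n)" for f v n
  proof (induction n)
    case 0
    show ?case by (simp add: ev_pr0 g)
  next
    case (Suc n)
    have "eval f h (n # rec_nat (G f v) (H f v) n # map v [0..<k])
        (H f v n (rec_nat (G f v) (H f v) n))"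
      using h[of f "\<lambda>i. case i of 0 \<Rightarrow> n | Suc 0 \<Rightarrow> rec_nat (G f v) (H f v) n | Suc (Suc j) \<Rightarrow> v j"]
      by (simp add: args del: upt_Suc)
    then show ?case using Suc by (auto intro: ev_prS)
  qed
  from this[of _ "v 0" "\<lambda>j. v (Suc j)" for v]
  have "cfun (Suc k) (\<lambda>f v. rec_nat (G f (\<lambda>j. v (Suc j))) (H f (\<lambda>j. v (Suc j))) (v 0))"
    unfolding cfun_def args by blast
  then show ?thesis by (rule cfun_subst) (intro cfun_var assms(3); simp)+
qed

lemma cfun_add [cintros]:
  assumes "cfun k A" "cfun k B" shows "cfun k (\<lambda>f v. A f v + B f v)"
proof -
  have "a + b = rec_nat a (\<lambda>_ r. Suc r) b" for a b :: nat
    by (induction b) auto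
  then show ?thesis by (simp only:) (intro cintros assms; simp)
qed

lemma cfun_mult [cintros]:
  assumes "cfun k A" "cfun k B" shows "cfun k (\<lambda>f v. A f v * B f v)"
proof (rule cfun_comp2[OF _ assms])
  have "a * b = rec_nat 0 (\<lambda>_ r. r + a) b" for a b :: nat
    by (induction b) auto
  then show "cfun 2 (\<lambda>f v. v 0 * v 1)" by (simp only:) (intro cintros; simp)
qed

lemma cfun_diff [cintros]:
  assumes "cfun k A" "cfun k B" shows "cfun k (\<lambda>f v. A f v - B f v)"
proof (rule cfun_comp2[OF _ assms])
  have p: "a - Suc 0 = rec_nat 0 (\<lambda>m _. m) a" for a :: nat
    by (induction a) auto
  have pred: "cfun k (\<lambda>f v. A f v - Suc 0)" if "cfun k A" for k A
    unfolding p by (intro cintros that; simp)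
  have diff_rec: "a - b = rec_nat a (\<lambda>_ r. r - Suc 0) b" for a b :: nat
    by (induction b) auto
  show "cfun 2 (\<lambda>f v. v 0 - v 1)"
    by (subst diff_rec) (intro cintros pred; simp)
qed

lemma cfun_power2 [cintros]:
  assumes "cfun k A" shows "cfun k (\<lambda>f v. 2 ^ A f v)"
proof -
  have "(2::nat) ^ b = rec_nat 1 (\<lambda>_ r. r + r) b" for b :: nat
    by (induction b) auto
  then show ?thesis by (simp only:) (intro cintros assms; simp)
qed

lemma cfun_half [cintros]:
  assumes "cfun k A" shows "cfun k (\<lambda>f v. A f v div 2)"
proof -
  \<comment> \<open>Halving becomes primitive recursive through
    \<open>Suc m div 2 = m - m div 2\<close>.\<close>
  have "a div 2 = rec_nat 0 (\<lambda>m r. m - r) a" for a :: nat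
  proof (induction a)
    case (Suc a)
    then show ?case by (simp flip: Suc)
  qed simp
  then show ?thesis by (simp only:) (intro cintros assms; simp)
qed

lemma cfun_sum [cintros]:
  assumes "cfun (Suc k) (\<lambda>f v. F f (\<lambda>j. v (Suc j)) (v 0))" "cfun k N"
  shows "cfun k (\<lambda>f v. \<Sum>i<N f v. F f v i)"
proof -
  have sum_rec: "(\<Sum>i<n. h i) = rec_nat 0 (\<lambda>i r. r + h i) n" for h :: "nat \<Rightarrow> nat" and n
    by (induction n) auto
  have "cfun (Suc (Suc k)) (\<lambda>f v. F f (\<lambda>j. v (Suc (Suc j))) (v 0))"
    by (intro cfun_subst[OF assms(1)] cintros; simp)
  then show ?thesis unfolding sum_rec by (intro cintros assms; simp)
qed

lemma cfun_of_bool [cintros]: "cpred k P \<Longrightarrow> cfun k (\<lambda>f v. of_bool (P f v))"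
  by (simp add: cpred_def)

lemma cpred_const [cintros]: "cpred k (\<lambda>f v. b)"
  unfolding cpred_def by (rule cfun_const)

lemma cpred_le [cintros]:
  assumes "cfun k A" "cfun k B" shows "cpred k (\<lambda>f v. A f v \<le> B f v)"
proof -
  have "of_bool (a \<le> b) = 1 - (a - b)" for a b :: nat by auto
  then show ?thesis unfolding cpred_def by (simp only:) (intro cintros assms)
qed

lemma cpred_not [cintros]:
  assumes "cpred k P" shows "cpred k (\<lambda>f v. \<not> P f v)"
proof -
  have "of_bool (\<not> p) = (1::nat) - of_bool p" for p by auto
  then show ?thesis unfolding cpred_def by (simp only:) (intro cintros assms)
qed

lemma cpred_conj [cintros]:
  assumes "cpred k P" "cpred k Q" shows "cpred k (\<lambda>f v. P f v \<and> Q f v)"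
proof -
  have "of_bool (p \<and> q) = (of_bool p :: nat) * of_bool q" for p q by auto
  then show ?thesis unfolding cpred_def by (simp only:) (intro cintros assms)
qed

lemma cpred_disj [cintros]:
  assumes "cpred k P" "cpred k Q" shows "cpred k (\<lambda>f v. P f v \<or> Q f v)"
proof -
  have "cpred k (\<lambda>f v. \<not> (\<not> P f v \<and> \<not> Q f v))" by (intro cintros assms)
  then show ?thesis by simp
qed

lemma cpred_less [cintros]:
  assumes "cfun k A" "cfun k B" shows "cpred k (\<lambda>f v. A f v < B f v)"
  unfolding not_le[symmetric] by (intro cintros assms)

lemma cpred_eq [cintros]:
  assumes "cfun k A" "cfun k B" shows "cpred k (\<lambda>f v. A f v = B f v)"
  unfolding eq_iff by (intro cintros assms)

lemma cpred_iff [cintros]: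
  assumes "cpred k P" "cpred k Q" shows "cpred k (\<lambda>f v. P f v \<longleftrightarrow> Q f v)"
proof -
  have "cpred k (\<lambda>f v. (P f v \<and> Q f v) \<or> (\<not> P f v \<and> \<not> Q f v))" by (intro cintros assms)
  then show ?thesis by (rule back_subst[of "cpred k"]) auto
qed

lemma cfun_if [cintros]:
  assumes "cpred k P" "cfun k A" "cfun k B"
  shows "cfun k (\<lambda>f v. if P f v then A f v else B f v)"
proof -
  have "(if p then a else b) = of_bool p * a + of_bool (\<not> p) * b" for p and a b :: nat by auto
  then show ?thesis by (simp only:) (intro cintros assms)
qed

lemma cpred_ex_less [cintros]:
  assumes "cpred (Suc k) (\<lambda>f v. P f (\<lambda>j. v (Suc j)) (v 0))" "cfun k N"
  shows "cpred k (\<lambda>f v. \<exists>i<N f v. P f v i)"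
proof -
  have "cpred k (\<lambda>f v. 0 < (\<Sum>i<N f v. of_bool (P f v i) :: nat))"
    by (intro cintros assms)
  moreover have "0 < (\<Sum>i<n. of_bool (p i) :: nat) \<longleftrightarrow> (\<exists>i<n. p i)" for n and p :: "nat \<Rightarrow> bool"
    by (simp flip: neq0_conv) auto
  ultimately show ?thesis by simp
qed

lemma cpred_all_less [cintros]:
  assumes "cpred (Suc k) (\<lambda>f v. P f (\<lambda>j. v (Suc j)) (v 0))" "cfun k N"
  shows "cpred k (\<lambda>f v. \<forall>i<N f v. P f v i)"
proof -
  have "cpred k (\<lambda>f v. \<not> (\<exists>i<N f v. \<not> P f v i))"
    by (intro cintros assms)
  then show ?thesis by simp
qed

lemma cpred_ex_le [cintros]:
  assumes "cpred (Suc k) (\<lambda>f v. P f (\<lambda>j. v (Suc j)) (v 0))" "cfun k N"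
  shows "cpred k (\<lambda>f v. \<exists>i\<le>N f v. P f v i)"
  unfolding less_Suc_eq_le[symmetric] by (intro cintros assms)

lemma cpred_all_le [cintros]:
  assumes "cpred (Suc k) (\<lambda>f v. P f (\<lambda>j. v (Suc j)) (v 0))" "cfun k N"
  shows "cpred k (\<lambda>f v. \<forall>i\<le>N f v. P f v i)"
  unfolding less_Suc_eq_le[symmetric] by (intro cintros assms)

lemma cpred_odd [cintros]:
  assumes "cfun k A" shows "cpred k (\<lambda>f v. odd (A f v))"
proof -
  have "odd a \<longleftrightarrow> \<not> a \<le> 2 * (a div 2)" for a :: nat by presburger
  then show ?thesis by (simp only:) (intro cintros assms)
qed

lemma cpred_bit [cintros]:
  assumes "cfun k A" "cfun k B" shows "cpred k (\<lambda>f v. bit (A f v) (B f v))"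
proof -
  have "bit a b \<longleftrightarrow> odd (rec_nat a (\<lambda>_ r. r div 2) b)" for a b :: nat
  proof -
    have "rec_nat a (\<lambda>_ r. r div 2) b = a div 2 ^ b"
      by (induction b) (simp_all add: div_mult2_eq[symmetric] mult.commute)
    then show ?thesis by (simp add: bit_iff_odd)
  qed
  then show ?thesis by (simp only:) (intro cintros assms; simp)
qed

section \<open>Codes of pairs and of prefixes\<close>

lemma cfun_prod_encode [cintros]:
  assumes "cfun k A" "cfun k B" shows "cfun k (\<lambda>f v. prod_encode (A f v, B f v))"
  unfolding prod_encode_def triangle_def by (simp, intro cintros assms)

text \<open>Programs handle numbers only, so strings enter them as an initial segment of a function.
  For 0/1-valued \<open>g\<close> this is the \<open>str_code\<close> of that segment, and
  \<open>g\<close> may be the oracle itself.\<close>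

definition prefix_code :: "(nat \<Rightarrow> nat) \<Rightarrow> nat \<Rightarrow> nat" where
  "prefix_code g l = list_encode (map g [0..<l])"

lemma cfun_prefix_code [cintros]:
  assumes "cfun (Suc k) (\<lambda>f v. G f (\<lambda>j. v (Suc j)) (v 0))" "cfun k L"
  shows "cfun k (\<lambda>f v. prefix_code (G f v) (L f v))"
proof -
  \<comment> \<open>\<open>list_encode\<close> wraps the head around the code of the tail, so the
    recursion has to start from the last entry: after n steps it holds the code of the final n
    entries.\<close>
  have code: "list_encode (map g [l - n..<l]) =
      rec_nat 0 (\<lambda>m r. Suc (prod_encode (g (l - Suc m), r))) n" if "n \<le> l" for g l n
    using that
  proof (induction n)
    case (Suc n)
    then have "[l - Suc n..<l] = (l - Suc n) # [l - n..<l]"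
      by (simp add: upt_conv_Cons Suc_diff_Suc)
    then show ?case using Suc by simp
  qed simp
  have prefix_rec: "prefix_code g l = rec_nat 0 (\<lambda>m r. Suc (prod_encode (g (l - Suc m), r))) l" for g l
    using code[of l l g] by (simp add: prefix_code_def)
  have "cfun (Suc (Suc k)) (\<lambda>f v. G f (\<lambda>j. v (Suc (Suc j))) (L f (\<lambda>j. v (Suc (Suc j))) - Suc (v 0)))"
  proof -
    have L: "cfun (Suc (Suc k)) (\<lambda>f v. L f (\<lambda>j. v (Suc (Suc j))))"
      by (rule cfun_comp[OF assms(2), of _ "\<lambda>i f v. v (Suc (Suc i))"]) (intro cintros; simp)
    show ?thesis by (intro cfun_subst[OF assms(1)] cintros L; simp)
  qed
  then show ?thesis unfolding prefix_rec by (intro cintros assms; simp)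
qed

section \<open>Stage-bounded evaluation and c.e. sets\<close>

text \<open>The stage t bounds the unbounded searches only. The value 0 means "undefined", and Suc v means
  "defined with value v". The oracle is the zero function.\<close>

primrec run :: "rf \<Rightarrow> nat \<Rightarrow> nat list \<Rightarrow> nat" where
  "run Zr = (\<lambda>t xs. 1)"
| "run Sc = (\<lambda>t xs. if length xs = 0 then 0 else Suc (Suc (xs ! 0)))"
| "run (Pj i) = (\<lambda>t xs. if i < length xs then Suc (xs ! i) else 0)"
| "run Orc = (\<lambda>t xs. if length xs = 0 then 0 else 1)"
| "run (Cn h gs) = (\<lambda>t xs. let ys = map (\<lambda>r. r t xs) (map run gs) in
     if \<exists>y\<in>set ys. y = 0 then 0 else run h t (map (\<lambda>y. y - 1) ys))"
| "run (Pr g h) = (\<lambda>t xs. if length xs = 0 then 0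
     else rec_nat (run g t (tl xs))
       (\<lambda>m r. if r = 0 then 0 else run h t (m # (r - 1) # tl xs)) (hd xs))"
| "run (Mn g) = (\<lambda>t xs. \<Sum>n<Suc t. if run g t (n # xs) = 1 \<and> (\<forall>m<n. 1 < run g t (m # xs))
     then Suc n else 0)"

lemma run_Cn: "run (Cn h gs) t xs = (if \<exists>g\<in>set gs. run g t xs = 0 then 0
    else run h t (map (\<lambda>g. run g t xs - 1) gs))"
  by (auto simp: o_def image_iff)

declare run.simps(5,7) [simp del] run_Cn [simp]

text \<open>At most one summand in the equation for \<open>Mn\<close> is nonzero, because a
  successful candidate has value 1 (a result 0) and all smaller ones exceed 1. The sum is thus a
  bounded search, in a form that \<open>cfun_sum\<close> covers.\<close>

lemma run_mu:
  "run (Mn g) t xs = Suc n \<longleftrightarrow>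
     n \<le> t \<and> run g t (n # xs) = 1 \<and> (\<forall>m<n. 1 < run g t (m # xs))"
proof -
  define P where "P n \<longleftrightarrow> run g t (n # xs) = 1 \<and> (\<forall>m<n. 1 < run g t (m # xs))" for n
  have run: "run (Mn g) t xs = (\<Sum>n<Suc t. if P n then Suc n else 0)"
    by (simp only: run.simps P_def)
  have unique: "n' = n" if "P n" "P n'" for n n'
    using that by (cases n n' rule: linorder_cases) (auto simp: P_def)
  have found: "run (Mn g) t xs = Suc n" if "n \<le> t" "P n" for n
  proof -
    have "P k \<longleftrightarrow> k = n" for k using unique that(2) by blast
    then show ?thesis unfolding run using that(1) by simp
  qed
  have "n \<le> t \<and> P n" if n: "run (Mn g) t xs = Suc n"
  proof -
    have "\<exists>k<Suc t. P k"
    proof (rule ccontr)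
      assume none: "\<not> (\<exists>k<Suc t. P k)"
      have "(if P k then Suc k else 0) = 0" if "k \<in> {..<Suc t}" for k
        using none that by auto
      then have "run (Mn g) t xs = 0" unfolding run by (rule sum.neutral[OF ballI])
      with n show False by (simp only: nat.distinct)
    qed
    then obtain k where k: "k \<le> t" "P k" by (auto simp: less_Suc_eq_le)
    have "k = n" using found[OF k] n by (simp only: nat.inject)
    with k show ?thesis by simp
  qed
  with found show ?thesis unfolding P_def by blast
qed

text \<open>A defined value rests on subcomputations that are all defined at stage \<open>t\<close>,
  and a larger stage only widens the searches. For \<open>Mn\<close>, the smaller candidates already
  have nonzero results at \<open>t\<close>, so no smaller solution can appear later.\<close>

lemma run_mono: "run e t xs = Suc v \<Longrightarrow> t \<le> t' \<Longrightarrow> run e t' xs = Suc v"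
proof (induction e arbitrary: xs v)
  case (Cn h gs)
  from Cn.prems(1) have nz: "\<And>g. g \<in> set gs \<Longrightarrow> run g t xs \<noteq> 0"
    and h: "run h t (map (\<lambda>g. run g t xs - 1) gs) = Suc v"
    by (auto split: if_splits)
  have same: "run g t' xs = run g t xs" if "g \<in> set gs" for g
    using Cn.IH(2)[OF that] nz[OF that] Cn.prems(2) by (metis not0_implies_Suc)
  have "map (\<lambda>g. run g t' xs - 1) gs = map (\<lambda>g. run g t xs - 1) gs"
    using same by simp
  then have "run h t' (map (\<lambda>g. run g t' xs - 1) gs) = Suc v"
    using Cn.IH(1)[OF h Cn.prems(2)] by (simp only:)
  then show ?case using nz same by simp
next
  case (Pr g h)
  define R where "R t = rec_nat (run g t (tl xs))
    (\<lambda>m r. if r = 0 then 0 else run h t (m # (r - 1) # tl xs))" for t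
  have "R t n = Suc v \<Longrightarrow> R t' n = Suc v" for n v
  proof (induction n arbitrary: v)
    case 0
    then show ?case using Pr.IH(1) Pr.prems(2) by (simp add: R_def)
  next
    case (Suc n)
    then obtain r where r: "R t n = Suc r" "run h t (n # r # tl xs) = Suc v"
      by (cases "R t n") (auto simp: R_def)
    show ?case using Suc.IH[OF r(1)] Pr.IH(2)[OF r(2) Pr.prems(2)] by (simp add: R_def)
  qed
  then show ?case using Pr.prems(1) by (auto simp: R_def split: if_splits)
next
  case (Mn g)
  have "run g t' (m # xs) = run g t (m # xs)" if "0 < run g t (m # xs)" for m
    using Mn.IH that Mn.prems(2) by (metis gr0_conv_Suc)
  then show ?case using Mn.prems unfolding run_mu by fastforce
qed (auto split: if_splits)

lemma run_sound: "run e t xs = Suc v \<Longrightarrow> eval (\<lambda>_. 0) e xs v"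
proof (induction e arbitrary: xs v)
  case Zr
  then show ?case by (simp add: ev_zero)
next
  case Sc
  then show ?case by (cases xs) (auto simp: ev_succ)
next
  case (Pj i)
  then show ?case by (auto simp: ev_proj split: if_splits)
next
  case Orc
  then show ?case using ev_orc[of "\<lambda>_. 0"] by (cases xs) simp_all
next
  case (Cn h gs)
  from Cn.prems have nz: "\<And>g. g \<in> set gs \<Longrightarrow> run g t xs \<noteq> 0"
    and h: "run h t (map (\<lambda>g. run g t xs - 1) gs) = Suc v"
    by (auto split: if_splits)
  show ?case
  proof (rule ev_comp[OF _ _ Cn.IH(1)[OF h]])
    show "\<forall>i<length gs. eval (\<lambda>_. 0) (gs ! i) xs (map (\<lambda>g. run g t xs - 1) gs ! i)"
    proof (intro allI impI)
      fix i assume i: "i < length gs"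
      then have g: "gs ! i \<in> set gs" by simp
      from nz[OF g] have "run (gs ! i) t xs = Suc (run (gs ! i) t xs - 1)" by simp
      from Cn.IH(2)[OF g this] i
      show "eval (\<lambda>_. 0) (gs ! i) xs (map (\<lambda>g. run g t xs - 1) gs ! i)" by simp
    qed
  qed simp
next
  case (Pr g h)
  then obtain n zs where xs: "xs = n # zs" by (cases xs) auto
  define R where "R = rec_nat (run g t zs)
    (\<lambda>m r. if r = 0 then 0 else run h t (m # (r - 1) # zs))"
  have "R n = Suc v \<Longrightarrow> eval (\<lambda>_. 0) (Pr g h) (n # zs) v" for n v
  proof (induction n arbitrary: v)
    case 0
    then show ?case using Pr.IH(1) by (simp add: R_def ev_pr0)
  next
    case (Suc n)
    then obtain r where r: "R n = Suc r" "run h t (n # r # zs) = Suc v"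
      by (cases "R n") (auto simp: R_def)
    show ?case using Suc.IH[OF r(1)] Pr.IH(2)[OF r(2)] by (rule ev_prS)
  qed
  then show ?case using Pr.prems unfolding R_def xs run.simps list.sel by simp
next
  case (Mn g)
  from Mn.prems have n: "run g t (v # xs) = Suc 0" "\<forall>m<v. 1 < run g t (m # xs)"
    unfolding run_mu by auto
  show ?case
  proof (rule ev_mu)
    show "eval (\<lambda>_. 0) g (v # xs) 0" using n(1) by (rule Mn.IH)
    show "\<forall>m<v. \<exists>w. w \<noteq> 0 \<and> eval (\<lambda>_. 0) g (m # xs) w"
    proof (intro allI impI)
      fix m assume "m < v"
      with n(2) have "run g t (m # xs) = Suc (run g t (m # xs) - 1)" "run g t (m # xs) - 1 \<noteq> 0"
        by fastforce+
      then show "\<exists>w. w \<noteq> 0 \<and> eval (\<lambda>_. 0) g (m # xs) w" using Mn.IH by blast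
    qed
  qed
qed

text \<open>Finitely many stages have a maximum. Besides the completeness of \<open>run\<close>,
  this later yields the convergence of the guesses and the finiteness of the waiting times.\<close>

lemma common_bound:
  fixes P :: "nat \<Rightarrow> nat \<Rightarrow> bool"
  assumes mono: "\<And>i t t'. P i t \<Longrightarrow> t \<le> t' \<Longrightarrow> P i t'"
  shows "\<forall>i<n. \<exists>t. P i t \<Longrightarrow> \<exists>t. \<forall>i<n. P i t"
proof (induction n)
  case (Suc n)
  then obtain t t' where t: "\<forall>i<n. P i t" and t': "P n t'"
    by (meson less_Suc_eq)
  have "P i (max t t')" if "i < Suc n" for i
  proof (cases "i = n")
    case True
    then show ?thesis using mono[OF t'] by simp
  next
    case False
    then have "P i t" using t that by simp
    then show ?thesis by (rule mono) simp
  qed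
  then show ?case by blast
qed simp

lemma run_complete: "eval (\<lambda>_. 0) e xs v \<Longrightarrow> \<exists>t. run e t xs = Suc v"
proof (induction rule: eval.induct)
  case (ev_comp ys gs xs h z)
  have "\<forall>i<length gs. \<exists>t. run (gs ! i) t xs = Suc (ys ! i)"
    using ev_comp.IH(1) by simp
  then have "\<exists>t. \<forall>i<length gs. run (gs ! i) t xs = Suc (ys ! i)"
    by (rule common_bound[rotated]) (rule run_mono)
  then obtain t1 where t1: "\<forall>i<length gs. run (gs ! i) t1 xs = Suc (ys ! i)" by blast
  obtain t2 where t2: "run h t2 ys = Suc z" using ev_comp.IH(2) by blast
  define t where "t = max t1 t2"
  have le: "t1 \<le> t" "t2 \<le> t" by (simp_all add: t_def)
  have gs: "run (gs ! i) t xs = Suc (ys ! i)" if "i < length gs" for i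
    using t1 that by (intro run_mono[OF _ le(1)]) simp
  then have "map (\<lambda>g. run g t xs - 1) gs = ys"
    using ev_comp.hyps(1) by (intro nth_equalityI) simp_all
  moreover have "\<not> (\<exists>g\<in>set gs. run g t xs = 0)"
  proof
    assume "\<exists>g\<in>set gs. run g t xs = 0"
    then obtain i where "i < length gs" "run (gs ! i) t xs = 0" by (auto simp: in_set_conv_nth)
    then show False using gs by simp
  qed
  ultimately have "run (Cn h gs) t xs = run h t ys" by (simp only: run_Cn if_False)
  then show ?case using run_mono[OF t2 le(2)] by (intro exI[of _ t]) (simp only:)
next
  case (ev_prS g h n xs y z)
  from ev_prS.IH(1) obtain t1 where t1: "run (Pr g h) t1 (n # xs) = Suc y" ..
  from ev_prS.IH(2) obtain t2 where t2: "run h t2 (n # y # xs) = Suc z" ..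
  have "run (Pr g h) (max t1 t2) (n # xs) = Suc y" "run h (max t1 t2) (n # y # xs) = Suc z"
    by (rule run_mono[OF t1], simp) (rule run_mono[OF t2], simp)
  then show ?case unfolding run.simps list.sel by (intro exI[of _ "max t1 t2"]) simp
next
  case (ev_mu g n xs)
  have "\<forall>m<n. \<exists>t. 1 < run g t (m # xs)"
  proof (intro allI impI)
    fix m assume "m < n"
    with ev_mu.IH(2) obtain w t where "w \<noteq> 0" "run g t (m # xs) = Suc w"
      by metis
    then show "\<exists>t. 1 < run g t (m # xs)" by (intro exI[of _ t]) simp
  qed
  moreover have mono: "1 < run g t' (m # xs)" if t: "1 < run g t (m # xs)" "t \<le> t'" for m t t'
  proof -
    from t(1) have "run g t (m # xs) = Suc (run g t (m # xs) - 1)" by simp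
    from run_mono[OF this t(2)] t(1) show ?thesis by simp
  qed
  ultimately have "\<exists>t. \<forall>m<n. 1 < run g t (m # xs)" by (rule common_bound[rotated])
  then obtain t1 where t1: "\<forall>m<n. 1 < run g t1 (m # xs)" by blast
  obtain t2 where t2: "run g t2 (n # xs) = Suc 0" using ev_mu.IH(1) by blast
  \<comment> \<open>The summand \<open>n\<close> is there because \<open>run (Mn g) t\<close> tries
    only candidates up to \<open>t\<close>.\<close>
  define t where "t = n + t1 + t2"
  have le: "n \<le> t" "t1 \<le> t" "t2 \<le> t" by (simp_all add: t_def)
  have "\<forall>m<n. 1 < run g t (m # xs)" using t1 mono[OF _ le(2)] by blast
  moreover have "run g t (n # xs) = 1" using run_mono[OF t2 le(3)] by simp
  ultimately have "run (Mn g) t xs = Suc n" unfolding run_mu using le(1) by blast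
  then show ?case by blast
next
  case (ev_pr0 g xs y h)
  from ev_pr0.IH obtain t where "run g t xs = Suc y" ..
  then show ?case by (intro exI[of _ t]) simp
qed simp_all

lemma cpred_bex_set:
  assumes "\<And>g. g \<in> set gs \<Longrightarrow> cpred k (\<lambda>f v. P g f v)"
  shows "cpred k (\<lambda>f v. \<exists>g\<in>set gs. P g f v)"
  using assms by (induction gs) (simp_all add: cpred_const cpred_disj)

lemma cfun_lift:
  assumes "cfun k A" shows "cfun (Suc k) (\<lambda>f v. A f (\<lambda>j. v (Suc j)))"
  by (rule cfun_comp[OF assms]) (rule cfun_var, simp)

text \<open>Induction on \<open>e\<close> builds a separate simulating program for each fixed
  program, so no universal program and no coding of programs is involved. The result works under
  every oracle although the simulated oracle is zero; this lets c.e. sets be used inside functionals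
  of p.\<close>

lemma cfun_run:
  assumes "cfun k T" and "\<And>i. i < n \<Longrightarrow> cfun k (V i)"
  shows "cfun k (\<lambda>f v. run e (T f v) (map (\<lambda>i. V i f v) [0..<n]))"
  using assms
proof (induction e arbitrary: k n T V)
  case Zr
  show ?case by (simp add: cfun_const)
next
  case Sc
  then show ?case by (cases n) (simp_all add: cfun_const cfun_Suc del: upt_Suc)
next
  case (Pj i)
  then show ?case by (cases "i < n") (simp_all add: cfun_const cfun_Suc)
next
  case Orc
  then show ?case by (simp add: cfun_const)
next
  case (Cn h gs)
  let ?xs = "\<lambda>f v. map (\<lambda>i. V i f v) [0..<n]"
  have g: "cfun k (\<lambda>f v. run g (T f v) (?xs f v))" if "g \<in> set gs" for g
    using that Cn.prems by (rule Cn.IH(2))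
  have "cfun k (\<lambda>f v. run h (T f v) (map (\<lambda>i. run (gs ! i) (T f v) (?xs f v) - 1) [0..<length gs]))"
    by (rule Cn.IH(1)[OF Cn.prems(1), of _ "\<lambda>i f v. run (gs ! i) (T f v) (?xs f v) - 1"])
      (intro cfun_diff cfun_const g nth_mem)
  moreover have "map (\<lambda>i. run (gs ! i) (T f v) (?xs f v) - 1) [0..<length gs]
      = map (\<lambda>g. run g (T f v) (?xs f v) - 1) gs" for f v
    by (intro nth_equalityI) simp_all
  ultimately have h: "cfun k (\<lambda>f v. run h (T f v) (map (\<lambda>g. run g (T f v) (?xs f v) - 1) gs))"
    by (simp only:)
  show ?case
    unfolding run_Cn by (intro cfun_if cpred_bex_set cpred_eq cfun_const g h)
next
  case (Pr g h)
  show ?case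
  proof (cases n)
    case (Suc n')
    have upt: "map w [0..<Suc n'] = w 0 # map (\<lambda>i. w (Suc i)) [0..<n']" for w :: "nat \<Rightarrow> nat" and n'
      by (simp add: map_upt_Suc del: upt_Suc)
    have V: "cfun k (V (Suc i))" if "i < n'" for i
      using Pr.prems(2) that Suc by simp
    \<comment> \<open>The arguments of the step program: the counter, the previous value with its
      \<open>Suc\<close> for "defined" removed, and the parameters lifted past the two new
      variables.\<close>
    define W where "W i = (case i of 0 \<Rightarrow> (\<lambda>f v. v 0) | Suc 0 \<Rightarrow> (\<lambda>f v. v (Suc 0) - 1)
      | Suc (Suc i) \<Rightarrow> (\<lambda>f v. V (Suc i) f (\<lambda>j. v (Suc (Suc j)))))"
      for i :: nat
    have "cfun (Suc (Suc k)) (W i)" if "i < Suc (Suc n')" for i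
      using that unfolding W_def
      by (cases i rule: nat.exhaust[case_product nat.exhaust])
        (auto split: nat.split simp: cfun_var cfun_const cfun_diff
          intro: cfun_lift[OF cfun_lift[OF V]])
    from Pr.IH(2)[where V = W and n = "Suc (Suc n')", OF cfun_lift[OF cfun_lift[OF Pr.prems(1)]] this]
    have h: "cfun (Suc (Suc k)) (\<lambda>f v. run h (T f (\<lambda>j. v (Suc (Suc j))))
        (v 0 # (v (Suc 0) - 1) # map (\<lambda>i. V (Suc i) f (\<lambda>j. v (Suc (Suc j)))) [0..<n']))"
      by (simp add: upt W_def del: upt_Suc)
    have g: "cfun k (\<lambda>f v. run g (T f v) (map (\<lambda>i. V (Suc i) f v) [0..<n']))"
      using Pr.prems(1) V by (rule Pr.IH(1))
    show ?thesis
      unfolding run.simps Suc upt list.sel length_Cons nat.distinct if_False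
      by (intro cfun_rec cfun_if cpred_eq cfun_const cfun_var g h Pr.prems(2)) (simp_all add: Suc cfun_const)
  qed (simp add: cfun_const)
next
  case (Mn g)
  have g: "cfun m (\<lambda>f v. run g (T f v) (A f v # map (\<lambda>i. V i f v) [0..<n]))"
    if "cfun m T" "cfun m A" "\<And>i. i < n \<Longrightarrow> cfun m (V i)" for m T A V
  proof -
    have "cfun m (case i of 0 \<Rightarrow> A | Suc i \<Rightarrow> V i)" if "i < Suc n" for i
      using that \<open>cfun m A\<close> \<open>\<And>i. i < n \<Longrightarrow> cfun m (V i)\<close> by (cases i) simp_all
    from Mn.IH[where n = "Suc n" and V = "\<lambda>i. case i of 0 \<Rightarrow> A | Suc i \<Rightarrow> V i", OF \<open>cfun m T\<close> this]
    show ?thesis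
      by (simp add: map_upt_Suc del: upt_Suc)
  qed
  show ?case unfolding run.simps
    by (intro cfun_sum cfun_if cpred_conj cpred_eq cpred_all_less cpred_less cfun_Suc cfun_const
        cfun_var g cfun_lift Mn.prems) simp_all
qed

text \<open>\<open>T t n\<close> says that the program for \<open>S\<close> halts on n by stage t.
  Halting is semi-decidable, but this approximation is decidable and monotone.\<close>

lemma ce_enumeration:
  assumes "ce S"
  obtains T where "\<And>n. n \<in> S \<longleftrightarrow> (\<exists>t. T t n)" and "\<And>t t' n. T t n \<Longrightarrow> t \<le> t' \<Longrightarrow> T t' n"
    and "\<And>k A B. cfun k A \<Longrightarrow> cfun k B \<Longrightarrow> cpred k (\<lambda>f v. T (A f v) (B f v))"
proof -
  obtain e where e: "\<And>n. n \<in> S \<longleftrightarrow> (\<exists>v. eval (\<lambda>_. 0) e [n] v)"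
    using assms by (auto simp: ce_def)
  show thesis
  proof (rule that[of "\<lambda>t n. 0 < run e t [n]"])
    show "n \<in> S \<longleftrightarrow> (\<exists>t. 0 < run e t [n])" for n
    proof
      assume "n \<in> S"
      then obtain v where "eval (\<lambda>_. 0) e [n] v" using e by blast
      then obtain t where "run e t [n] = Suc v" using run_complete by blast
      then show "\<exists>t. 0 < run e t [n]" by (metis zero_less_Suc)
    next
      assume "\<exists>t. 0 < run e t [n]"
      then obtain t v where "run e t [n] = Suc v" by (auto simp: gr0_conv_Suc)
      then show "n \<in> S" using e run_sound by blast
    qed
    show "0 < run e t' [n]" if "0 < run e t [n]" "t \<le> t'" for t t' n
    proof -
      from that(1) obtain v where "run e t [n] = Suc v" by (auto simp: gr0_conv_Suc)
      from run_mono[OF this that(2)] show ?thesis by simp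
    qed
    have "cfun (Suc (Suc 0)) (\<lambda>f v. run e (v 0) [v (Suc 0)])"
      using cfun_run[of "Suc (Suc 0)" "\<lambda>f v. v 0" 1 "\<lambda>_ f v. v (Suc 0)" e]
      by (simp add: cfun_var)
    then have "cfun k (\<lambda>f v. run e (A f v) [B f v])" if "cfun k A" "cfun k B" for k A B
      using cfun_comp2[of "\<lambda>f a b. run e a [b]" k A B] that by (simp add: numeral_2_eq_2)
    then show "cpred k (\<lambda>f v. 0 < run e (A f v) [B f v])" if "cfun k A" "cfun k B" for k A B
      using that by (intro cintros)
  qed
qed

text \<open>The converse direction: an unbounded search for t halts exactly on the projection. The
  test is negated because \<open>Mn\<close> looks for the value 0.\<close>

lemma ce_exists:
  assumes "cpred (Suc (Suc 0)) (\<lambda>f v. P (v 0) (v (Suc 0)))"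
  shows "ce {n. \<exists>t. P t n}"
proof -
  have "cfun (Suc (Suc 0)) (\<lambda>f v. of_bool (\<not> P (v 0) (v (Suc 0))))"
    by (intro cintros assms)
  then obtain e where e: "\<And>f v. eval f e (map v [0..<Suc (Suc 0)]) (of_bool (\<not> P (v 0) (v (Suc 0))))"
    unfolding cfun_def by blast
  have e: "eval f e [t, n] (of_bool (\<not> P t n))" for f t n
    using e[of f "\<lambda>i. if i = 0 then t else n"] by simp
  have "(\<exists>t. P t n) \<longleftrightarrow> (\<exists>v. eval (\<lambda>_. 0) (Mn e) [n] v)" for n
  proof
    assume "\<exists>t. P t n"
    then obtain t where t: "P t n" "\<And>m. m < t \<Longrightarrow> \<not> P m n"
      using exists_least_iff[of "\<lambda>t. P t n"] by blast
    have "eval (\<lambda>_. 0) (Mn e) [n] t"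
    proof (rule ev_mu)
      show "eval (\<lambda>_. 0) e [t, n] 0" using e[of _ t n] t(1) by simp
      show "\<forall>m<t. \<exists>v. v \<noteq> 0 \<and> eval (\<lambda>_. 0) e [m, n] v"
      proof (intro allI impI exI conjI)
        fix m assume "m < t"
        then show "eval (\<lambda>_. 0) e [m, n] 1" using e[of _ m n] t(2) by simp
      qed simp
    qed
    then show "\<exists>v. eval (\<lambda>_. 0) (Mn e) [n] v" by blast
  next
    assume "\<exists>v. eval (\<lambda>_. 0) (Mn e) [n] v"
    then obtain t where "eval (\<lambda>_. 0) e [t, n] 0" by (blast elim: eval_MnE)
    then have "of_bool (\<not> P t n) = (0::nat)" using e eval_deterministic by blast
    then show "\<exists>t. P t n" by (intro exI[of _ t]) (simp split: if_splits)
  qed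
  then show ?thesis unfolding ce_def by auto
qed

section \<open>Cantor space and randomness\<close>

lemma str_code_eq_prefix_code:
  "str_code (map P [0..<l]) = prefix_code (\<lambda>m. of_bool (P m)) l"
  by (simp add: str_code_def prefix_code_def o_def)

lemma prefix_code_cong: "(\<And>m. m < l \<Longrightarrow> g m = h m) \<Longrightarrow> prefix_code g l = prefix_code h l"
  unfolding prefix_code_def by (intro arg_cong[where f = list_encode] map_cong) auto

lemma pair_code_inject: "pair_code i \<sigma> = pair_code j \<tau> \<longleftrightarrow> i = j \<and> \<sigma> = \<tau>"
proof -
  have "inj (of_bool :: bool \<Rightarrow> nat)" by (auto simp: inj_def)
  then show ?thesis
    by (auto simp: pair_code_def str_code_def list_encode_eq prod_encode_eq inj_map_eq_map)
qed

lemma pair_code_mem_iff: "pair_code i \<sigma> \<in> {pair_code i \<sigma> | i \<sigma>. cyl \<sigma> \<subseteq> V i} \<longleftrightarrow> cyl \<sigma> \<subseteq> V i"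
  by (auto simp: pair_code_inject)

text \<open>Strings of length l are represented by the bits of numbers below \<open>2 ^ l\<close>,
  so that quantifying over strings is bounded quantification over numbers. Read as a sequence,
  \<open>bit y\<close> is the string followed by zeros.\<close>

lemma bits_eq:
  obtains y :: nat where "y < 2 ^ l" and "\<And>m. bit y m \<longleftrightarrow> m < l \<and> P m"
proof
  let ?y = "horner_sum of_bool (2::nat) (map P [0..<l])"
  show "?y < 2 ^ l" using horner_sum_of_bool_2_less[of "map P [0..<l]"] by simp
  show "bit ?y m \<longleftrightarrow> m < l \<and> P m" for m
    by (auto simp: bit_horner_sum_bit_iff)
qed

lemma string_bits:
  obtains y :: nat where "y < 2 ^ length \<sigma>" and "\<sigma> = map (bit y) [0..<length \<sigma>]"
proof -
  obtain y :: nat where y: "y < 2 ^ length \<sigma>" "\<And>m. bit y m \<longleftrightarrow> m < length \<sigma> \<and> \<sigma> ! m"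
    using bits_eq[of "length \<sigma>" "\<lambda>m. \<sigma> ! m"] by blast
  have "\<sigma> = map (bit y) [0..<length \<sigma>]"
    using y(2) by (intro nth_equalityI) simp_all
  with y(1) show thesis by (rule that)
qed

lemma cyl_map_upt: "X \<in> cyl (map P [0..<l]) \<longleftrightarrow> (\<forall>m<l. X m = P m)"
  by (auto simp: cyl_def)

lemma cyl_prefix:
  assumes "X \<in> cyl \<sigma>" shows "\<sigma> = map X [0..<length \<sigma>]"
  using assms by (intro nth_equalityI) (auto simp: cyl_def)

section \<open>Stage approximations of uniformly effectively open sequences\<close>

definition enumerates :: "(nat \<Rightarrow> nat \<Rightarrow> bool) \<Rightarrow> (nat \<Rightarrow> cantor set) \<Rightarrow> bool" where
  "enumerates T V \<longleftrightarrow> (\<forall>i \<sigma>. cyl \<sigma> \<subseteq> V i \<longleftrightarrow> (\<exists>t. T t (pair_code i \<sigma>))) \<and>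
    (\<forall>t t' n. T t n \<longrightarrow> t \<le> t' \<longrightarrow> T t' n) \<and>
    (\<forall>k A B. cfun k A \<longrightarrow> cfun k B \<longrightarrow> cpred k (\<lambda>f v. T (A f v) (B f v)))"

lemma enumerates_mono: "enumerates T V \<Longrightarrow> T t n \<Longrightarrow> t \<le> t' \<Longrightarrow> T t' n"
  unfolding enumerates_def by blast

lemma enumerates_iff: "enumerates T V \<Longrightarrow> cyl \<sigma> \<subseteq> V i \<longleftrightarrow> (\<exists>t. T t (pair_code i \<sigma>))"
  unfolding enumerates_def by blast

lemma enumerates_cpred:
  "enumerates T V \<Longrightarrow> cfun k A \<Longrightarrow> cfun k B \<Longrightarrow> cpred k (\<lambda>f v. T (A f v) (B f v))"
  unfolding enumerates_def by blast

lemma unif_eff_open_enumerates: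
  assumes "unif_eff_open V"
  obtains T where "enumerates T V"
proof -
  have "ce {pair_code i \<sigma> | i \<sigma>. cyl \<sigma> \<subseteq> V i}"
    using assms by (simp add: unif_eff_open_def)
  then obtain T where T: "\<And>n. n \<in> {pair_code i \<sigma> | i \<sigma>. cyl \<sigma> \<subseteq> V i} \<longleftrightarrow> (\<exists>t. T t n)"
    "\<And>t t' n. T t n \<Longrightarrow> t \<le> t' \<Longrightarrow> T t' n"
    "\<And>k A B. cfun k A \<Longrightarrow> cfun k B \<Longrightarrow> cpred k (\<lambda>f v. T (A f v) (B f v))"
    by (rule ce_enumeration) blast
  have "cyl \<sigma> \<subseteq> V i \<longleftrightarrow> (\<exists>t. T t (pair_code i \<sigma>))" for i \<sigma>
    using T(1)[of "pair_code i \<sigma>"] unfolding pair_code_mem_iff .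
  then have "enumerates T V"
    unfolding enumerates_def by (intro conjI allI impI) (assumption | rule T(2,3))+
  then show thesis by (rule that)
qed

section \<open>Invariance of effective openness under flipping one bit\<close>

definition flip :: "nat \<Rightarrow> cantor \<Rightarrow> cantor" where
  "flip k X = (\<lambda>m. if m = k then \<not> X m else X m)"

lemma flip_flip [simp]: "flip k (flip k X) = X"
  by (auto simp: flip_def)

lemma flip_mem_cyl: "flip k X \<in> cyl (map P [0..<l]) \<longleftrightarrow> X \<in> cyl (map (flip k P) [0..<l])"
  by (auto simp: cyl_map_upt flip_def)

lemma cyl_subset_flip:
  "cyl (map P [0..<l]) \<subseteq> flip k -` V \<longleftrightarrow> cyl (map (flip k P) [0..<l]) \<subseteq> V"
proof
  assume L: "cyl (map P [0..<l]) \<subseteq> flip k -` V"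
  show "cyl (map (flip k P) [0..<l]) \<subseteq> V"
  proof
    fix X assume "X \<in> cyl (map (flip k P) [0..<l])"
    then have "flip k X \<in> cyl (map P [0..<l])" by (simp only: flip_mem_cyl)
    with L have "flip k X \<in> flip k -` V" by (rule subsetD)
    then show "X \<in> V" by simp
  qed
next
  assume R: "cyl (map (flip k P) [0..<l]) \<subseteq> V"
  show "cyl (map P [0..<l]) \<subseteq> flip k -` V"
  proof
    fix X assume "X \<in> cyl (map P [0..<l])"
    then have "flip k X \<in> cyl (map (flip k P) [0..<l])" by (simp add: flip_mem_cyl)
    then show "X \<in> flip k -` V" using R by auto
  qed
qed

text \<open>A cylinder lies in the preimage exactly when the cylinder of the flipped string lies in
  \<open>V i\<close>. An enumeration thus searches for an index and a string, the latter given by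
  bits \<open>y\<close> and length \<open>l\<close>, all bounded by the stage t.\<close>

lemma unif_eff_open_flip:
  assumes "unif_eff_open V"
  shows "unif_eff_open (\<lambda>i. flip k -` V i)"
proof -
  obtain T where T: "enumerates T V" using assms by (rule unif_eff_open_enumerates)
  define P where "P t n \<longleftrightarrow> (\<exists>i\<le>t. \<exists>y\<le>t. \<exists>l\<le>t.
      n = prod_encode (i, prefix_code (\<lambda>m. of_bool (bit y m)) l) \<and>
      T t (prod_encode (i, prefix_code (\<lambda>m. of_bool (if m = k then \<not> bit y m else bit y m)) l)))"
    for t n
  \<comment> \<open>\<open>cfun_if\<close> covers numeric branches only; a Boolean \<open>if\<close>
    has to be spelled out with connectives.\<close>
  have if_conv: "(if m = k then \<not> bit y m else bit y m) \<longleftrightarrow> (m = k \<and> \<not> bit y m) \<or> (\<not> m = k \<and> bit y m)"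
    for m and y :: nat by simp
  have "ce {n. \<exists>t. P t n}"
  proof (rule ce_exists)
    show "cpred (Suc (Suc 0)) (\<lambda>f v. P (v 0) (v (Suc 0)))"
      unfolding P_def if_conv by (intro cintros enumerates_cpred[OF T]; simp)
  qed
  also have "{n. \<exists>t. P t n} = {pair_code i \<sigma> | i \<sigma>. cyl \<sigma> \<subseteq> flip k -` V i}"
  proof -
    have code: "prod_encode (i, prefix_code (\<lambda>m. of_bool (bit y m)) l) = pair_code i (map (bit y) [0..<l])"
      "prod_encode (i, prefix_code (\<lambda>m. of_bool (if m = k then \<not> bit y m else bit y m)) l)
        = pair_code i (map (flip k (bit y)) [0..<l])" for i l and y :: nat
      by (simp_all add: pair_code_def str_code_eq_prefix_code flip_def)
    show ?thesis
    proof (intro set_eqI iffI)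
      fix n assume "n \<in> {n. \<exists>t. P t n}"
      then obtain t i l and y :: nat where n: "n = pair_code i (map (bit y) [0..<l])"
        and t: "T t (pair_code i (map (flip k (bit y)) [0..<l]))"
        unfolding P_def code mem_Collect_eq by (elim exE conjE)
      from t have "cyl (map (flip k (bit y)) [0..<l]) \<subseteq> V i"
        unfolding enumerates_iff[OF T] by (rule exI)
      then have "cyl (map (bit y) [0..<l]) \<subseteq> flip k -` V i" unfolding cyl_subset_flip .
      with n show "n \<in> {pair_code i \<sigma> | i \<sigma>. cyl \<sigma> \<subseteq> flip k -` V i}"
        by blast
    next
      fix n assume "n \<in> {pair_code i \<sigma> | i \<sigma>. cyl \<sigma> \<subseteq> flip k -` V i}"
      then obtain i \<sigma> where n: "n = pair_code i \<sigma>" "cyl \<sigma> \<subseteq> flip k -` V i" by blast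
      define l where "l = length \<sigma>"
      obtain y :: nat where y: "\<sigma> = map (bit y) [0..<l]"
        unfolding l_def by (rule string_bits)
      obtain t where t: "T t (pair_code i (map (flip k (bit y)) [0..<l]))"
        using n(2) unfolding y cyl_subset_flip enumerates_iff[OF T] ..
      define t' where "t' = t + i + y + l"
      have "T t' (pair_code i (map (flip k (bit y)) [0..<l]))"
        by (rule enumerates_mono[OF T t]) (simp add: t'_def)
      moreover have "i \<le> t'" "y \<le> t'" "l \<le> t'" by (simp_all add: t'_def)
      ultimately have "P t' n" unfolding P_def code n(1) y
        by (intro exI[of _ i] exI[of _ y] exI[of _ l] conjI refl)
      then show "n \<in> {n. \<exists>t. P t n}" by blast
    qed
  qed
  finally have "ce {pair_code i \<sigma> | i \<sigma>. cyl \<sigma> \<subseteq> flip k -` V i}" .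
  moreover have "cantor_open (flip k -` V i)" for i
    unfolding cantor_open_def
  proof
    fix X assume "X \<in> flip k -` V i"
    then obtain \<sigma> where s: "flip k X \<in> cyl \<sigma>" "cyl \<sigma> \<subseteq> V i"
      using assms unfolding unif_eff_open_def cantor_open_def by blast
    define l where "l = length \<sigma>"
    have \<sigma>: "\<sigma> = map (flip k X) [0..<l]" using cyl_prefix[OF s(1)] by (simp add: l_def)
    have "X \<in> cyl (map X [0..<l])" by (simp add: cyl_map_upt)
    moreover have "cyl (map X [0..<l]) \<subseteq> flip k -` V i"
      unfolding cyl_subset_flip using s(2) \<sigma> by simp
    ultimately show "\<exists>\<sigma>. X \<in> cyl \<sigma> \<and> cyl \<sigma> \<subseteq> flip k -` V i" by blast
  qed
  ultimately show ?thesis unfolding unif_eff_open_def by blast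
qed

section \<open>Invariance of measure and randomness under finite changes\<close>

lemma space_lam [simp]: "space lam = UNIV"
  by (simp add: lam_def space_PiM)

lemma measurable_lam_component:
  "(\<lambda>X. P (X m)) \<in> lam \<rightarrow>\<^sub>M measure_pmf (bernoulli_pmf (1/2))"
proof -
  have "(\<lambda>X. X m) \<in> lam \<rightarrow>\<^sub>M measure_pmf (bernoulli_pmf (1/2))"
    unfolding lam_def by (rule measurable_component_singleton) simp
  from measurable_compose[OF this, of P] show ?thesis by simp
qed

lemma sets_cyl [measurable]: "cyl \<sigma> \<in> sets lam"
proof -
  have "{X \<in> space lam. X k = b} \<in> sets lam" for k b
    using measurable_sets[OF measurable_lam_component[of "\<lambda>b. b" k], of "{b}"]
    by (simp add: vimage_def)
  then have "{X \<in> space lam. \<forall>k<length \<sigma>. X k = \<sigma> ! k} \<in> sets lam"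
    using sets.sets_Collect_finite_All'[of "{..<length \<sigma>}" lam "\<lambda>k X. X k = \<sigma> ! k"]
      sets.top[of lam]
    by (cases "\<sigma> = []") (auto simp: Ball_def)
  then show ?thesis by (simp add: cyl_def)
qed

lemma sets_cantor_open: "cantor_open V \<Longrightarrow> V \<in> sets lam"
proof -
  assume V: "cantor_open V"
  have "V = (\<Union>\<sigma>\<in>{\<sigma>. cyl \<sigma> \<subseteq> V}. cyl \<sigma>)"
    using V unfolding cantor_open_def by blast
  also have "\<dots> \<in> sets lam"
    by (rule sets.countable_UN'') (auto intro: sets_cyl)
  finally show ?thesis .
qed

lemma flip_measurable: "flip k \<in> lam \<rightarrow>\<^sub>M lam"
proof -
  have "(\<lambda>X. \<lambda>m. flip k X m) \<in>
      lam \<rightarrow>\<^sub>M PiM UNIV (\<lambda>_::nat. measure_pmf (bernoulli_pmf (1/2)))"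
  proof (rule measurable_PiM_single')
    show "(\<lambda>X. flip k X m) \<in> lam \<rightarrow>\<^sub>M measure_pmf (bernoulli_pmf (1/2))" for m
      using measurable_lam_component[of Not m] measurable_lam_component[of "\<lambda>b. b" m]
      by (cases "m = k") (simp_all add: flip_def)
  qed (simp add: space_PiM)
  then show ?thesis by (simp add: lam_def)
qed

text \<open>A fair coin is invariant under negation, so both measures agree on finite-dimensional
  boxes, and these determine a finite measure on the product.\<close>

lemma distr_flip: "distr lam lam (flip k) = lam"
proof -
  let ?M = "\<lambda>_::nat. measure_pmf (bernoulli_pmf (1/2))"
  interpret product_prob_space ?M UNIV by unfold_locales
  have Not: "emeasure (measure_pmf (bernoulli_pmf (1/2))) (Not -` B) =
      emeasure (measure_pmf (bernoulli_pmf (1/2))) B" for B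
  proof -
    have "map_pmf Not (bernoulli_pmf (1/2)) = bernoulli_pmf (1/2)"
      unfolding bernoulli_pmf_half_conv_pmf_of_set
      by (rule map_pmf_of_set_bij_betw) (auto simp: bij_betw_def inj_def surj_def)
    then show ?thesis by (metis emeasure_map_pmf)
  qed
  show ?thesis
    unfolding lam_def
  proof (rule measure_eqI_PiM_infinite[where M = ?M and I = UNIV])
    fix A and J :: "nat set"
    assume J: "finite J"
    define A' where "A' i = (if i = k then Not -` A i else A i)" for i
    have box: "prod_emb UNIV ?M J (Pi\<^sub>E J A) = {X \<in> space (PiM UNIV ?M). \<forall>i\<in>J. X i \<in> A i}" for A
      unfolding prod_emb_def by (auto simp: space_PiM PiE_iff)
    have box_meas: "prod_emb UNIV ?M J (Pi\<^sub>E J A) \<in> sets (PiM UNIV ?M)"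
      by (rule sets_PiM_I) (auto simp: J)
    have "emeasure (distr (PiM UNIV ?M) (PiM UNIV ?M) (flip k)) (prod_emb UNIV ?M J (Pi\<^sub>E J A)) =
        emeasure (PiM UNIV ?M) (flip k -` prod_emb UNIV ?M J (Pi\<^sub>E J A) \<inter> space (PiM UNIV ?M))"
      using flip_measurable[of k] box_meas unfolding lam_def by (rule emeasure_distr)
    also have "flip k -` prod_emb UNIV ?M J (Pi\<^sub>E J A) \<inter> space (PiM UNIV ?M)
        = {X \<in> space (PiM UNIV ?M). \<forall>i\<in>J. X i \<in> A' i}"
      unfolding box by (auto simp: space_PiM A'_def flip_def split: if_splits)
    also have "emeasure (PiM UNIV ?M) \<dots> = (\<Prod>i\<in>J. emeasure (?M i) (A' i))"
      by (rule emeasure_PiM_Collect) (auto simp: J)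
    also have "\<dots> = (\<Prod>i\<in>J. emeasure (?M i) (A i))"
      by (rule prod.cong) (simp_all add: A'_def Not)
    also have "\<dots> = emeasure (PiM UNIV ?M) (prod_emb UNIV ?M J (Pi\<^sub>E J A))"
      unfolding box by (rule emeasure_PiM_Collect[symmetric]) (auto simp: J)
    finally show "emeasure (distr (PiM UNIV ?M) (PiM UNIV ?M) (flip k)) (prod_emb UNIV ?M J (Pi\<^sub>E J A))
        = emeasure (PiM UNIV ?M) (prod_emb UNIV ?M J (Pi\<^sub>E J A))" .
  next
    have "prob_space (distr (PiM UNIV ?M) (PiM UNIV ?M) (flip k))"
      using flip_measurable[of k] unfolding lam_def by (rule prob_space_distr)
    then show "finite_measure (distr (PiM UNIV ?M) (PiM UNIV ?M) (flip k))"
      by (rule prob_space.finite_measure)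
  qed simp_all
qed

lemma mltest_flip:
  assumes "mltest V" shows "mltest (\<lambda>i. flip k -` V i)"
  unfolding mltest_def
proof (intro conjI allI)
  have V: "unif_eff_open V" using assms by (simp add: mltest_def)
  then show "unif_eff_open (\<lambda>i. flip k -` V i)" by (rule unif_eff_open_flip)
  fix i
  have "V i \<in> sets lam" using V by (intro sets_cantor_open) (simp add: unif_eff_open_def)
  then have "emeasure (distr lam lam (flip k)) (V i) = emeasure lam (flip k -` V i \<inter> space lam)"
    by (rule emeasure_distr[OF flip_measurable])
  then have "emeasure lam (flip k -` V i) = emeasure lam (V i)"
    by (simp add: distr_flip)
  also have "\<dots> \<le> ennreal ((1/2) ^ i)" using assms by (simp add: mltest_def)
  finally show "emeasure lam (flip k -` V i) \<le> ennreal ((1/2) ^ i)" .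
qed

text \<open>A test capturing the flipped sequence pulls back along \<open>flip k\<close> to a test
  capturing X.\<close>

lemma MLR_flip:
  assumes "X \<in> MLR" shows "flip k X \<in> MLR"
  unfolding MLR_def
proof (intro CollectI allI impI notI)
  fix V assume "mltest V" and X: "flip k X \<in> (\<Inter>i. V i)"
  from assms mltest_flip[OF \<open>mltest V\<close>, of k] have "X \<notin> (\<Inter>i. flip k -` V i)"
    unfolding MLR_def by blast
  with X show False by simp
qed

text \<open>Induction on the set of differing positions, removing one by a flip at each
  step.\<close>

lemma MLR_finite_change:
  assumes "finite {n. X n \<noteq> Y n}" "X \<in> MLR"
  shows "Y \<in> MLR"
proof -
  have "finite D \<Longrightarrow> X \<in> MLR \<Longrightarrow> {n. X n \<noteq> Y n} = D \<Longrightarrow> Y \<in> MLR" for D X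
  proof (induction D arbitrary: X rule: finite_induct)
    case empty
    then have "X = Y" by auto
    with empty show ?case by simp
  next
    case (insert k D)
    have "{n. flip k X n \<noteq> Y n} = D"
    proof (rule set_eqI)
      fix n
      have "X n \<noteq> Y n \<longleftrightarrow> n = k \<or> n \<in> D" using insert.prems(2) by blast
      then show "n \<in> {n. flip k X n \<noteq> Y n} \<longleftrightarrow> n \<in> D"
        using insert.hyps(2) by (cases "n = k") (auto simp: flip_def)
    qed
    from insert.IH[OF MLR_flip[OF insert.prems(1)] this] show ?case .
  qed
  from this[OF assms refl] show ?thesis .
qed

section \<open>Strings followed by zeros are not random\<close>

lemma mltest_zeros: "mltest (\<lambda>i. cyl (map (\<lambda>_. False) [0..<i]))"
  unfolding mltest_def unif_eff_open_def
proof (intro conjI allI)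
  let ?Z = "\<lambda>i. cyl (map (\<lambda>_. False) [0..<i])"
  show "cantor_open (?Z i)" for i
    unfolding cantor_open_def by blast
  define P where "P t n \<longleftrightarrow> (\<exists>i\<le>t. \<exists>y\<le>t. \<exists>l\<le>t. i \<le> l \<and> (\<forall>m<i. \<not> bit y m) \<and>
      n = prod_encode (i, prefix_code (\<lambda>m. of_bool (bit y m)) l))" for t n
  have "ce {n. \<exists>t. P t n}"
  proof (rule ce_exists)
    show "cpred (Suc (Suc 0)) (\<lambda>f v. P (v 0) (v (Suc 0)))"
      unfolding P_def by (intro cintros; simp)
  qed
  also have "{n. \<exists>t. P t n} = {pair_code i \<sigma> | i \<sigma>. cyl \<sigma> \<subseteq> ?Z i}"
  proof -
    have code: "prod_encode (i, prefix_code (\<lambda>m. of_bool (bit y m)) l) = pair_code i (map (bit y) [0..<l])"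
      for i l and y :: nat
      by (simp add: pair_code_def str_code_eq_prefix_code)
    have sub: "cyl (map (bit y) [0..<l]) \<subseteq> ?Z i \<longleftrightarrow> i \<le> l \<and> (\<forall>m<i. \<not> bit y m)" for i l and y :: nat
    proof
      assume L: "cyl (map (bit y) [0..<l]) \<subseteq> ?Z i"
      \<comment> \<open>The string continued with ones. Its membership in \<open>?Z i\<close> shows
        at once that the first i bits are zero and that none of them comes from the continuation,
        hence \<open>i \<le> l\<close>.\<close>
      have "(\<lambda>m. m < l \<longrightarrow> bit y m) \<in> cyl (map (bit y) [0..<l])"
        by (simp add: cyl_map_upt)
      with L have "(\<lambda>m. m < l \<longrightarrow> bit y m) \<in> ?Z i" by (rule subsetD)
      then have *: "\<And>m. m < i \<Longrightarrow> m < l \<and> \<not> bit y m" by (auto simp: cyl_map_upt)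
      have "i \<le> l" using *[of l] by (meson less_irrefl not_le)
      with * show "i \<le> l \<and> (\<forall>m<i. \<not> bit y m)" by blast
    next
      assume "i \<le> l \<and> (\<forall>m<i. \<not> bit y m)"
      then show "cyl (map (bit y) [0..<l]) \<subseteq> ?Z i" by (auto simp: cyl_map_upt)
    qed
    show ?thesis
    proof (intro set_eqI iffI)
      fix n assume "n \<in> {n. \<exists>t. P t n}"
      then obtain t i l and y :: nat where n: "n = pair_code i (map (bit y) [0..<l])"
        and y: "i \<le> l" "\<forall>m<i. \<not> bit y m"
        unfolding P_def code mem_Collect_eq by (elim exE conjE)
      with sub[of y l i] show "n \<in> {pair_code i \<sigma> | i \<sigma>. cyl \<sigma> \<subseteq> ?Z i}" by blast
    next
      fix n assume "n \<in> {pair_code i \<sigma> | i \<sigma>. cyl \<sigma> \<subseteq> ?Z i}"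
      then obtain i \<sigma> where n: "n = pair_code i \<sigma>" "cyl \<sigma> \<subseteq> ?Z i" by blast
      define l where "l = length \<sigma>"
      obtain y :: nat where y: "\<sigma> = map (bit y) [0..<l]"
        unfolding l_def by (rule string_bits)
      have yi: "i \<le> l" "\<forall>m<i. \<not> bit y m" using n(2) unfolding y sub by simp_all
      define t where "t = i + y + l"
      have "i \<le> t" "y \<le> t" "l \<le> t" by (simp_all add: t_def)
      with yi have "P t n" unfolding P_def code n(1) y
        by (intro exI[of _ i] exI[of _ y] exI[of _ l] conjI refl)
      then show "n \<in> {n. \<exists>t. P t n}" by blast
    qed
  qed
  finally show "ce {pair_code i \<sigma> | i \<sigma>. cyl \<sigma> \<subseteq> ?Z i}" .
next
  fix i
  let ?M = "\<lambda>_::nat. measure_pmf (bernoulli_pmf (1/2))"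
  interpret product_prob_space ?M UNIV by unfold_locales
  have "cyl (map (\<lambda>_. False) [0..<i]) = {X \<in> space (PiM UNIV ?M). \<forall>m\<in>{..<i}. X m \<in> {False}}"
    by (auto simp: cyl_map_upt space_PiM)
  then have "emeasure lam (cyl (map (\<lambda>_. False) [0..<i])) = (\<Prod>m<i. emeasure (?M m) {False})"
    unfolding lam_def by (simp only:) (rule emeasure_PiM_Collect, simp_all)
  also have "\<dots> = ennreal (1/2) ^ i"
    by (simp add: emeasure_pmf_single)
  also have "\<dots> = ennreal ((1/2) ^ i)"
    by (rule ennreal_power) simp
  finally show "emeasure lam (cyl (map (\<lambda>_. False) [0..<i])) \<le> ennreal ((1/2) ^ i)" by simp
qed

lemma finite_support_not_MLR:
  assumes "finite {n. Y n}" shows "Y \<notin> MLR"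
proof
  assume "Y \<in> MLR"
  then have "(\<lambda>_. False) \<in> MLR" by (rule MLR_finite_change[of Y, rotated]) (simp add: assms)
  have "(\<lambda>_. False) \<notin> (\<Inter>i. cyl (map (\<lambda>_. False) [0..<i]))"
    by (fact \<open>(\<lambda>_. False) \<in> MLR\<close>[unfolded MLR_def mem_Collect_eq, rule_format, OF mltest_zeros])
  moreover have "(\<lambda>_. False) \<in> (\<Inter>i. cyl (map (\<lambda>_. False) [0..<i]))" by (simp add: cyl_map_upt)
  ultimately show False by (rule notE)
qed

text \<open>Here the universality of \<open>U\<close> enters: \<open>bit y\<close> has finite
  support, hence is captured by some test and so by every component of \<open>U\<close>. This
  guarantees that each waiting period ends.\<close>

lemma universal_mltest_bit:
  assumes "universal_mltest U" shows "bit (y::nat) \<in> U j"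
proof -
  have "n < y" if "bit y n" for n
  proof (rule ccontr)
    assume "\<not> n < y"
    then have "y < 2 ^ n" by (intro le_less_trans[OF _ less_exp]) simp
    then have "y div 2 ^ n = 0" by simp
    with that show False by (simp only: bit_iff_odd) simp
  qed
  then have "{n. bit y n} \<subseteq> {..<y}" by auto
  then have "finite {n. bit y n}" by (rule finite_subset) simp
  then have "bit y \<notin> MLR" by (rule finite_support_not_MLR)
  then have "\<exists>V. mltest V \<and> bit y \<in> (\<Inter>i. V i)"
    unfolding MLR_def mem_Collect_eq not_all not_imp not_not .
  then obtain V where V: "mltest V" "bit y \<in> (\<Inter>i. V i)" by (elim exE conjE)
  have "(\<Inter>i. V i) \<subseteq> (\<Inter>i. U i)" using assms V(1) unfolding universal_mltest_def by simp
  from subsetD[OF this V(2)] show ?thesis by (rule INT_D) simp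
qed

section \<open>The reduction\<close>

definition hits :: "(nat \<Rightarrow> nat \<Rightarrow> bool) \<Rightarrow> (nat \<Rightarrow> nat) \<Rightarrow> nat \<Rightarrow> nat \<Rightarrow> bool" where
  "hits T p i s \<longleftrightarrow> (\<exists>l\<le>s. T s (prod_encode (i, prefix_code p l)))"

lemma hits_mono:
  assumes "enumerates T V" "hits T p i s" "s \<le> s'"
  shows "hits T p i s'"
proof -
  from assms(2) obtain l where l: "l \<le> s" "T s (prod_encode (i, prefix_code p l))"
    unfolding hits_def by blast
  from enumerates_mono[OF assms(1) l(2) assms(3)] l(1) assms(3) show ?thesis
    unfolding hits_def by (intro exI[of _ l] conjI) simp_all
qed

lemma prefix_code_binary:
  assumes "\<And>n. p n \<le> 1"
  shows "prefix_code p l = str_code (map (\<lambda>n. p n = 1) [0..<l])"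
proof -
  have "p n = of_bool (p n = 1)" for n using assms[of n] by (cases "p n") auto
  then show ?thesis unfolding str_code_eq_prefix_code by (intro prefix_code_cong) 
qed

text \<open>Openness provides a prefix whose cylinder lies inside \<open>V i\<close>; the stage must
  exceed both the length of that prefix and the time of its enumeration.\<close>

lemma hits_iff:
  assumes T: "enumerates T V" and V: "cantor_open (V i)" and p: "\<And>n. p n \<le> 1"
  shows "(\<exists>s. hits T p i s) \<longleftrightarrow> (\<lambda>n. p n = 1) \<in> V i" (is "_ \<longleftrightarrow> ?X \<in> V i")
proof
  assume "\<exists>s. hits T p i s"
  then obtain s l where "T s (pair_code i (map ?X [0..<l]))"
    unfolding hits_def prefix_code_binary[OF p] pair_code_def by blast
  then have "cyl (map ?X [0..<l]) \<subseteq> V i" unfolding enumerates_iff[OF T] by (rule exI)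
  then show "?X \<in> V i" by (rule subsetD) (simp add: cyl_map_upt)
next
  assume "?X \<in> V i"
  with V obtain \<sigma> where s: "?X \<in> cyl \<sigma>" "cyl \<sigma> \<subseteq> V i" unfolding cantor_open_def by blast
  define l where "l = length \<sigma>"
  have \<sigma>: "\<sigma> = map ?X [0..<l]" using cyl_prefix[OF s(1)] by (simp only: l_def)
  obtain t where "T t (pair_code i \<sigma>)" using s(2) unfolding enumerates_iff[OF T] ..
  then have "T (t + l) (pair_code i \<sigma>)" by (rule enumerates_mono[OF T]) simp
  then have "hits T p i (t + l)"
    unfolding hits_def prefix_code_binary[OF p] pair_code_def \<sigma> by (intro exI[of _ l] conjI) simp_all
  then show "\<exists>s. hits T p i s" ..
qed

lemma cfun_lift_under:
  assumes "cfun (Suc k) (\<lambda>f v. F f (\<lambda>j. v (Suc j)) (v 0))"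
  shows "cfun (Suc (Suc k)) (\<lambda>f v. F f (\<lambda>j. v (Suc (Suc j))) (v 0))"
  by (rule cfun_subst[OF assms]) (intro cintros; simp)+

lemma cpred_hits:
  assumes T: "enumerates T V" and p: "cfun (Suc k) (\<lambda>f v. p f (\<lambda>j. v (Suc j)) (v 0))"
    and i: "cfun k I" and s: "cfun k S"
  shows "cpred k (\<lambda>f v. hits T (p f v) (I f v) (S f v))"
  unfolding hits_def
  by (intro cpred_ex_le enumerates_cpred[OF T] cfun_prod_encode cfun_prefix_code
      cfun_lift_under[OF p] cfun_lift[OF i] cfun_lift[OF s] s cfun_var) simp_all

text \<open>This counts the i for which W 0, ..., W i have all been hit, so it converges to the least index
  of a component of W that is never hit.\<close>

definition guess :: "(nat \<Rightarrow> nat \<Rightarrow> bool) \<Rightarrow> (nat \<Rightarrow> nat) \<Rightarrow> nat \<Rightarrow> nat" where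
  "guess T p s = (\<Sum>i<Suc s. of_bool (\<forall>i'\<le>i. hits T p i' s))"

lemma cfun_guess:
  assumes T: "enumerates T V" and p: "cfun (Suc k) (\<lambda>f v. p f (\<lambda>j. v (Suc j)) (v 0))"
    and s: "cfun k S"
  shows "cfun k (\<lambda>f v. guess T (p f v) (S f v))"
  unfolding guess_def
  by (intro cfun_sum cfun_of_bool cpred_all_le cpred_hits[OF T] cfun_Suc
      cfun_lift_under[OF cfun_lift_under[OF p]] cfun_lift[OF cfun_lift[OF s]] s cfun_var) simp_all

lemma guess_converges:
  assumes T: "enumerates T W" and W: "\<And>i. cantor_open (W i)" and p: "\<And>n. p n \<le> 1"
    and out: "(\<lambda>n. p n = 1) \<notin> W i" and least: "\<And>j. j < i \<Longrightarrow> (\<lambda>n. p n = 1) \<in> W j"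
  shows "\<exists>s0. \<forall>s\<ge>s0. guess T p s = i"
proof -
  have "\<forall>j<i. \<exists>s. hits T p j s" using least hits_iff[of T W _ p, OF T W p] by simp
  then have "\<exists>s. \<forall>j<i. hits T p j s"
    by (rule common_bound[rotated]) (rule hits_mono[OF T])
  then obtain s1 where s1: "\<forall>j<i. hits T p j s1" ..
  have never: "\<not> hits T p i s" for s using out hits_iff[of T W i p, OF T W p] by blast
  \<comment> \<open>From \<open>s1\<close> on, all components before \<open>i\<close> are hit;
    \<open>s \<ge> i\<close> makes the range of the sum long enough to count all of them.\<close>
  have "guess T p s = i" if s: "s \<ge> max s1 i" for s
  proof -
    have "(\<forall>i'\<le>j. hits T p i' s) \<longleftrightarrow> j < i" for j
    proof
      assume "\<forall>i'\<le>j. hits T p i' s"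
      then show "j < i" using never by (meson not_le)
    next
      assume "j < i"
      show "\<forall>i'\<le>j. hits T p i' s"
      proof (intro allI impI)
        fix i' assume "i' \<le> j"
        with \<open>j < i\<close> s1 have "hits T p i' s1" by simp
        then show "hits T p i' s" by (rule hits_mono[OF T]) (use s in simp)
      qed
    qed
    then have "guess T p s = (\<Sum>j<Suc s. of_bool (j < i))" unfolding guess_def by (simp only:)
    also have "\<dots> = card ({..<Suc s} \<inter> {j. j < i})" by (simp only: sum_of_bool_eq finite_lessThan of_nat_id)
    also have "{..<Suc s} \<inter> {j. j < i} = {..<i}" using s by auto
    finally show ?thesis by simp
  qed
  then show ?thesis by blast
qed

section \<open>Turing functionals from the closure rules\<close>

lemma turing_functional_total:
  assumes "cfun (Suc 0) (\<lambda>f v. F f (v 0))"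
  shows "turing_functional (\<lambda>p. Some (F p))"
proof -
  obtain e where e: "\<And>f v. eval f e (map v [0..<Suc 0]) (F f (v 0))"
    using assms unfolding cfun_def by blast
  have e: "eval f e [n] (F f n)" for f n using e[of f "\<lambda>_. n"] by simp
  have "(THE v. eval f e [n] v) = F f n" for f n
    by (rule the_equality, rule e, erule eval_deterministic[OF e])
  moreover have "\<forall>n. \<exists>v. eval f e [n] v" for f using e by blast
  ultimately show ?thesis unfolding turing_functional_def by (intro exI[of _ e]) simp
qed

text \<open>The program \<open>Cn h [Mn d, Pj 0]\<close> repeats the search for each output position
  n. It yields a partial functional, described only on oracles where the search succeeds; on a name
  of a number the search reads off that number.\<close>

lemma turing_functional_search:
  assumes D: "cpred (Suc (Suc 0)) (\<lambda>f v. D f (v 0))"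
    and F: "cfun (Suc (Suc 0)) (\<lambda>f v. F f (v 0) (v (Suc 0)))"
  obtains \<Psi> where "turing_functional \<Psi>"
    and "\<And>f j. D f j \<Longrightarrow> (\<And>m. m < j \<Longrightarrow> \<not> D f m) \<Longrightarrow> \<Psi> f = Some (F f j)"
proof -
  have "cfun (Suc (Suc 0)) (\<lambda>f v. of_bool (\<not> D f (v 0)))" by (intro cintros D)
  then obtain d where d: "\<And>f v. eval f d (map v [0..<Suc (Suc 0)]) (of_bool (\<not> D f (v 0)))"
    unfolding cfun_def by blast
  have d: "eval f d [j, n] (of_bool (\<not> D f j))" for f j n
    using d[of f "\<lambda>i. if i = 0 then j else n"] by simp
  obtain h where h: "\<And>f v. eval f h (map v [0..<Suc (Suc 0)]) (F f (v 0) (v (Suc 0)))"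
    using F unfolding cfun_def by blast
  have h: "eval f h [j, n] (F f j n)" for f j n
    using h[of f "\<lambda>i. if i = 0 then j else n"] by simp
  define e where "e = Cn h [Mn d, Pj 0]"
  define \<Psi> where "\<Psi> p = (if \<forall>n. \<exists>v. eval p e [n] v then Some (\<lambda>n. THE v. eval p e [n] v) else None)"
    for p
  show thesis
  proof (rule that[of \<Psi>])
    show "turing_functional \<Psi>" unfolding turing_functional_def \<Psi>_def by (intro exI[of _ e] allI refl)
    fix f j assume j: "D f j" "\<And>m. m < j \<Longrightarrow> \<not> D f m"
    have ev: "eval f e [n] (F f j n)" for n
      unfolding e_def
    proof (rule ev_comp[where ys = "[j, n]"])
      have "eval f (Mn d) [n] j"
      proof (rule ev_mu)
        show "eval f d [j, n] 0" using d[of f j n] j(1) by simp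
        show "\<forall>m<j. \<exists>v. v \<noteq> 0 \<and> eval f d [m, n] v"
        proof (intro allI impI exI conjI)
          fix m assume "m < j"
          then show "eval f d [m, n] 1" using d[of f m n] j(2) by simp
        qed simp
      qed
      moreover have "eval f (Pj 0) [n] n" using ev_proj[of 0 "[n]" f] by simp
      ultimately show "\<forall>i<length [Mn d, Pj 0]. eval f ([Mn d, Pj 0] ! i) [n] ([j, n] ! i)"
        by (simp add: less_Suc_eq)
    qed (simp_all add: h)
    have "(THE v. eval f e [n] v) = F f j n" for n
      by (rule the_equality, rule ev, erule eval_deterministic[OF ev])
    with ev show "\<Psi> f = Some (F f j)" unfolding \<Psi>_def by auto
  qed
qed

lemma delta_nat_indicator: "delta_nat (\<lambda>k. if k = n then 1 else 0) = Some n"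
proof -
  have "n' = n" if "(\<lambda>k. if k = n then 1 else 0) = (\<lambda>k. if k = n' then 1 else (0::nat))" for n'
    using fun_cong[OF that, of n] by (simp split: if_splits)
  then have "(THE n'. (\<lambda>k. if k = n then 1 else 0) = (\<lambda>k. if k = n' then 1 else (0::nat))) = n"
    by (intro the_equality) simp_all
  then show ?thesis unfolding delta_nat_def by auto
qed

lemma delta_nat_SomeD:
  assumes "delta_nat q = Some n" shows "q = (\<lambda>k. if k = n then 1 else 0)"
proof -
  have "\<exists>n. q = (\<lambda>k. if k = n then 1 else 0)"
    by (rule ccontr) (use assms in \<open>simp add: delta_nat_def\<close>)
  then obtain n' where q: "q = (\<lambda>k. if k = n' then 1 else 0)" ..
  then have "n' = n" using assms delta_nat_indicator[of n'] by simp
  with q show ?thesis by simp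
qed

text \<open>The guess for membership in \<open>A\<close>: outside \<open>W i\<close> the set
  \<open>A\<close> coincides with the i-th set enumerated by \<open>T'\<close>, so once the guessed
  i is right, a hit of that set is evidence for \<open>A\<close>. A change of i may revoke an
  earlier answer.\<close>

definition flag :: "(nat \<Rightarrow> nat \<Rightarrow> bool) \<Rightarrow> (nat \<Rightarrow> nat \<Rightarrow> bool) \<Rightarrow> (nat \<Rightarrow> nat) \<Rightarrow> nat \<Rightarrow> bool" where
  "flag T T' p s \<longleftrightarrow> hits T' p (guess T p s) s"

definition changes :: "(nat \<Rightarrow> nat \<Rightarrow> bool) \<Rightarrow> (nat \<Rightarrow> nat \<Rightarrow> bool) \<Rightarrow> (nat \<Rightarrow> nat) \<Rightarrow> nat \<Rightarrow> bool" where
  "changes T T' p s \<longleftrightarrow> guess T p s \<noteq> guess T p (Suc s) \<or> flag T T' p s \<noteq> flag T T' p (Suc s)"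

text \<open>Every string of length s, given by the bits of y, lies in each of U 0, ..., U s by stage n
  when it is followed by zeros.\<close>

definition covered :: "(nat \<Rightarrow> nat \<Rightarrow> bool) \<Rightarrow> nat \<Rightarrow> nat \<Rightarrow> bool" where
  "covered T s n \<longleftrightarrow> (\<forall>j\<le>s. \<forall>y<2 ^ s. hits T (\<lambda>m. of_bool (bit (y::nat) m)) j n)"

text \<open>All pending changes are served by the same zeros: position n is overwritten as long as
  some change \<open>s \<le> n\<close> still waits. No clause refers to values written
  before.\<close>

definition modified ::
  "(nat \<Rightarrow> nat \<Rightarrow> bool) \<Rightarrow> (nat \<Rightarrow> nat \<Rightarrow> bool) \<Rightarrow> (nat \<Rightarrow> nat \<Rightarrow> bool) \<Rightarrow> (nat \<Rightarrow> nat) \<Rightarrow> nat \<Rightarrow> nat" where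
  "modified R T T' p n = (if \<exists>s\<le>n. changes T T' p s \<and> \<not> covered R s n then 0 else p n)"

lemma cpred_flag:
  assumes "enumerates T W" "enumerates T' V" "cfun (Suc k) (\<lambda>f v. p f (\<lambda>j. v (Suc j)) (v 0))" "cfun k S"
  shows "cpred k (\<lambda>f v. flag T T' (p f v) (S f v))"
  unfolding flag_def by (intro cpred_hits[OF assms(2)] cfun_guess[OF assms(1)] assms)

lemma cpred_changes:
  assumes "enumerates T W" "enumerates T' V" "cfun (Suc k) (\<lambda>f v. p f (\<lambda>j. v (Suc j)) (v 0))" "cfun k S"
  shows "cpred k (\<lambda>f v. changes T T' (p f v) (S f v))"
  unfolding changes_def
  by (intro cpred_disj cpred_not cpred_eq cpred_iff cfun_Suc
      cpred_flag[OF assms(1,2)] cfun_guess[OF assms(1)] assms)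

lemma cpred_covered:
  assumes "enumerates T U" "cfun k S" "cfun k N"
  shows "cpred k (\<lambda>f v. covered T (S f v) (N f v))"
  unfolding covered_def
  by (intro cpred_all_le cpred_all_less cpred_hits[OF assms(1)] cfun_of_bool cpred_bit cfun_power2
      cfun_var cfun_lift[OF cfun_lift[OF assms(3)]] cfun_lift[OF assms(2)] assms(2)) simp_all

lemma cfun_modified:
  assumes "enumerates R U" "enumerates T W" "enumerates T' V"
  shows "cfun (Suc 0) (\<lambda>f v. modified R T T' f (v 0))"
  unfolding modified_def
  by (intro cfun_if cpred_ex_le cpred_conj cpred_not cpred_changes[OF assms(2,3)]
      cpred_covered[OF assms(1)] cfun_oracle cfun_const cfun_var) simp_all

lemma covered_mono:
  assumes T: "enumerates T U" "covered T s n" "n \<le> n'"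
  shows "covered T s n'"
  unfolding covered_def
proof (intro allI impI)
  fix j y assume "j \<le> s" "y < (2::nat) ^ s"
  then have "hits T (\<lambda>m. of_bool (bit y m)) j n" using T(2) unfolding covered_def by simp
  then show "hits T (\<lambda>m. of_bool (bit y m)) j n'" by (rule hits_mono[OF T(1) _ T(3)])
qed

text \<open>For each of the finitely many pairs of an index and a string, the string followed by
  zeros lies in the component of \<open>U\<close>; the two nested bounds merge the stages at which
  this is seen.\<close>

lemma covered_eventually:
  assumes T: "enumerates T U" and U: "universal_mltest U" and open_U: "\<And>i. cantor_open (U i)"
  shows "\<exists>n. covered T s n"
proof -
  let ?hits = "\<lambda>j y. hits T (\<lambda>m. of_bool (bit (y::nat) m)) j"
  have "\<exists>n. ?hits j y n" for j y
  proof -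
    have "(\<exists>n. ?hits j y n) \<longleftrightarrow> (\<lambda>m. of_bool (bit y m) = (1::nat)) \<in> U j"
      by (rule hits_iff[OF T open_U]) simp
    then show ?thesis using universal_mltest_bit[OF U, of y j] by simp
  qed
  then have "\<forall>y<2^s. \<exists>n. ?hits j y n" for j by simp
  then have "\<exists>n. \<forall>y<2^s. ?hits j y n" for j
    by (rule common_bound[rotated]) (rule hits_mono[OF T])
  then have "\<forall>j<Suc s. \<exists>n. \<forall>y<2^s. ?hits j y n" by simp
  then have "\<exists>n. \<forall>j<Suc s. \<forall>y<2^s. ?hits j y n"
  proof (rule common_bound[rotated], intro allI impI)
    fix j n n' y assume "\<forall>y<2^s. ?hits j y n" "n \<le> n'" "y < (2::nat)^s"
    then have "?hits j y n" by simp
    then show "?hits j y n'" by (rule hits_mono[OF T _ \<open>n \<le> n'\<close>])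
  qed
  then show ?thesis unfolding covered_def less_Suc_eq_le .
qed

lemma modified_mem:
  assumes R: "enumerates R U" and U: "universal_mltest U" and open_U: "\<And>i. cantor_open (U i)"
    and p: "\<And>n. p n \<le> 1" and change: "changes T T' p s" and js: "j \<le> s"
  shows "(\<lambda>n. modified R T T' p n = 1) \<in> U j"
proof -
  let ?Y = "modified R T T' p"
  have Y: "?Y n \<le> 1" for n using p by (simp add: modified_def)
  \<comment> \<open>Until this stage the change at \<open>s\<close> forces zeros from position s on.
    Below n the output is therefore its own prefix of length s followed by zeros, and a hit at stage
    n inspects no position beyond that.\<close>
  define n where "n = (LEAST n. covered R s n)"
  have cov: "covered R s n"
    unfolding n_def using covered_eventually[OF R U open_U] by (rule LeastI_ex)
  have zero: "?Y m = 0" if "s \<le> m" "m < n" for m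
  proof -
    have "\<not> covered R s m" using that(2) unfolding n_def by (rule not_less_Least)
    with that(1) change have "\<exists>s\<le>m. changes T T' p s \<and> \<not> covered R s m" by blast
    then show ?thesis unfolding modified_def by (rule if_P)
  qed
  obtain y :: nat where y: "y < 2 ^ s" "\<And>m. bit y m \<longleftrightarrow> m < s \<and> ?Y m = 1"
    using bits_eq[of s "\<lambda>m. ?Y m = 1"] by blast
  have same: "of_bool (bit y m) = ?Y m" if "m < n" for m
    using Y[of m] zero[of m] that unfolding y(2) by (cases "m < s") (auto simp: le_Suc_eq)
  have "hits R (\<lambda>m. of_bool (bit y m)) j n" using cov js y(1) unfolding covered_def by simp
  then obtain l where l: "l \<le> n" "R n (prod_encode (j, prefix_code (\<lambda>m. of_bool (bit y m)) l))"
    unfolding hits_def by (elim exE conjE)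
  have "prefix_code (\<lambda>m. of_bool (bit y m)) l = prefix_code ?Y l"
    by (rule prefix_code_cong, rule same) (use l(1) in simp)
  with l have "hits R ?Y j n" unfolding hits_def by (intro exI[of _ l] conjI) simp_all
  then have "\<exists>s. hits R ?Y j s" ..
  then show ?thesis unfolding hits_iff[of R U j ?Y, OF R open_U Y] .
qed

text \<open>Once the guess has settled on the least index \<open>i0\<close> outside
  \<open>W\<close>, the flag is just \<open>hits T' p i0 s\<close>. This is monotone in s, so it
  settles too, and its limit is membership in \<open>V i0\<close>, which agrees with
  \<open>A\<close> for this sequence.\<close>

lemma stable_flag:
  assumes T: "enumerates T W" and W: "\<And>i. cantor_open (W i)" and T': "enumerates T' V"
    and V: "\<And>i. cantor_open (V i)"
    and p: "\<And>n. p n \<le> 1" and out: "(\<lambda>n. p n = 1) \<notin> W i"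
    and A: "\<And>i. A \<inter> - W i = V i \<inter> - W i"
  obtains s0 where "\<And>s. s0 \<le> s \<Longrightarrow> flag T T' p s \<longleftrightarrow> (\<lambda>n. p n = 1) \<in> A"
    and "\<And>s. s0 \<le> s \<Longrightarrow> \<not> changes T T' p s"
proof -
  let ?X = "\<lambda>n. p n = 1"
  define i0 where "i0 = (LEAST i. ?X \<notin> W i)"
  have i0: "?X \<notin> W i0" unfolding i0_def using out by (rule LeastI)
  have least: "?X \<in> W j" if "j < i0" for j
    using not_less_Least[OF that[unfolded i0_def]] by simp
  from guess_converges[of T W p i0, OF T W p i0 least]
  obtain s1 where s1: "\<And>s. s1 \<le> s \<Longrightarrow> guess T p s = i0" by blast
  have A_iff: "?X \<in> A \<longleftrightarrow> (\<exists>s. hits T' p i0 s)"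
  proof -
    have "?X \<in> A \<longleftrightarrow> ?X \<in> A \<inter> - W i0" using i0 by simp
    also have "\<dots> \<longleftrightarrow> ?X \<in> V i0" unfolding A using i0 by simp
    finally show ?thesis using hits_iff[of T' V i0 p, OF T' V p] by simp
  qed
  have "\<exists>s2. \<forall>s\<ge>s2. hits T' p i0 s \<longleftrightarrow> ?X \<in> A"
  proof (cases "?X \<in> A")
    case True
    then obtain s2 where s2: "hits T' p i0 s2" using A_iff by blast
    have "hits T' p i0 s" if "s2 \<le> s" for s by (rule hits_mono[OF T' s2 that])
    with True show ?thesis by blast
  next
    case False
    then show ?thesis using A_iff by blast
  qed
  then obtain s2 where s2: "\<And>s. s2 \<le> s \<Longrightarrow> hits T' p i0 s \<longleftrightarrow> ?X \<in> A" by blast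
  have flag: "flag T T' p s \<longleftrightarrow> ?X \<in> A" if "max s1 s2 \<le> s" for s
    using that s1[of s] s2[of s] by (simp add: flag_def)
  show thesis
  proof (rule that[of "max s1 s2", OF flag])
    fix s assume s: "max s1 s2 \<le> s"
    then show "\<not> changes T T' p s"
      using flag[of s] flag[of "Suc s"] s1[of s] s1[of "Suc s"] unfolding changes_def by simp
  qed
qed

text \<open>Only the finitely many stages below \<open>s0\<close> can be changes, and being covered
  is permanent, so from a common stage on the input is copied unaltered.\<close>

lemma finite_modified:
  assumes R: "enumerates R U" and U: "universal_mltest U" and open_U: "\<And>i. cantor_open (U i)"
    and stable: "\<And>s. s0 \<le> s \<Longrightarrow> \<not> changes T T' p s"
  shows "finite {n. modified R T T' p n \<noteq> p n}"
proof -
  have "\<forall>s<s0. \<exists>n. covered R s n" using covered_eventually[OF R U open_U] by simp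
  then have "\<exists>n. \<forall>s<s0. covered R s n"
    by (rule common_bound[rotated]) (rule covered_mono[OF R])
  then obtain N where N: "\<forall>s<s0. covered R s N" ..
  have "modified R T T' p n = p n" if "N \<le> n" for n
  proof -
    have "covered R s n" if "changes T T' p s" for s
    proof -
      have "s < s0" using stable that by (meson not_le)
      then have "covered R s N" using N by simp
      then show ?thesis by (rule covered_mono[OF R _ \<open>N \<le> n\<close>])
    qed
    then show ?thesis unfolding modified_def by (intro if_not_P) blast
  qed
  then have "{n. modified R T T' p n \<noteq> p n} \<subseteq> {..<N}" by (auto simp: not_le[symmetric])
  then show ?thesis by (rule finite_subset) simp
qed

theorem theorem6p1:
  fixes W U :: "nat \<Rightarrow> cantor set" and A :: "cantor set"
  assumes "universal_mltest W" and "universal_mltest U"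
    and "layerwise_semidec W A"
  shows "weihrauch_le delta_MLR delta_nat (chi_MLR A) delta_MLR delta_nat (LAY U)"
proof -
  have test_W: "mltest W" and test_U: "mltest U"
    using assms(1,2) unfolding universal_mltest_def by simp_all
  obtain V where "unif_eff_open V" and A: "\<And>i. A \<inter> - W i = V i \<inter> - W i"
    using assms(3) unfolding layerwise_semidec_def by (elim exE conjE) simp
  moreover have "unif_eff_open W" "unif_eff_open U"
    using test_W test_U by (simp_all add: mltest_def)
  ultimately have open_W: "\<And>i. cantor_open (W i)" and open_U: "\<And>i. cantor_open (U i)"
    and open_V: "\<And>i. cantor_open (V i)"
    by (simp_all add: unif_eff_open_def)
  obtain T where T: "enumerates T W" by (rule unif_eff_open_enumerates[OF \<open>unif_eff_open W\<close>])
  obtain R where R: "enumerates R U" by (rule unif_eff_open_enumerates[OF \<open>unif_eff_open U\<close>])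
  obtain T' where T': "enumerates T' V" by (rule unif_eff_open_enumerates[OF \<open>unif_eff_open V\<close>])
  define \<Phi> where "\<Phi> p = Some (modified R T T' p)" for p
  have \<Phi>: "turing_functional \<Phi>"
    unfolding \<Phi>_def by (rule turing_functional_total[OF cfun_modified[OF R T T']])
  \<comment> \<open>In \<open>pair_seq p r\<close> the even positions carry p and the odd ones the
    name r of the returned index; that index is the first j with value 1 at
    \<open>Suc (2 * j)\<close>. The output is the name of the flag at stage j as 0 or 1.\<close>
  obtain \<Psi> where \<Psi>: "turing_functional \<Psi>"
    and \<Psi>_eq: "\<And>f j. f (Suc (2 * j)) = 1 \<Longrightarrow> (\<And>m. m < j \<Longrightarrow> f (Suc (2 * m)) \<noteq> 1) \<Longrightarrow>
      \<Psi> f = Some (\<lambda>n. of_bool (n = of_bool (flag T T' (\<lambda>l. f (2 * l)) j)))"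
  proof (rule turing_functional_search[of "\<lambda>f j. f (Suc (2 * j)) = 1"
      "\<lambda>f j n. of_bool (n = of_bool (flag T T' (\<lambda>l. f (2 * l)) j))"])
    show "cpred (Suc (Suc 0)) (\<lambda>f v. f (Suc (2 * v 0)) = 1)"
      by (intro cintros) simp
    show "cfun (Suc (Suc 0)) (\<lambda>f v. of_bool (v (Suc 0) = of_bool (flag T T' (\<lambda>l. f (2 * l)) (v 0))))"
      by (intro cintros cpred_flag[OF T T']) simp_all
  qed blast
  have "realizes delta_MLR delta_nat (chi_MLR A)
      (\<lambda>p. Option.bind (\<Phi> p) (\<lambda>q. Option.bind (\<Gamma> q) (\<lambda>r. \<Psi> (pair_seq p r))))"
    if \<Gamma>: "realizes delta_MLR delta_nat (LAY U) \<Gamma>" for \<Gamma>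
    unfolding realizes_def
  proof (intro allI impI)
    fix p X assume "delta_MLR p = Some X"
    then have p: "\<And>n. p n \<le> 1" and X: "X = (\<lambda>n. p n = 1)" "X \<in> MLR"
      by (simp_all add: delta_MLR_def split: if_splits)
    obtain i where "X \<notin> W i" using X(2) test_W unfolding MLR_def by auto
    then obtain s0 where flag: "\<And>s. s0 \<le> s \<Longrightarrow> flag T T' p s \<longleftrightarrow> X \<in> A"
      and stable: "\<And>s. s0 \<le> s \<Longrightarrow> \<not> changes T T' p s"
      unfolding X(1) using stable_flag[of T W T' V p, OF T open_W T' open_V p _ A] by blast
    define Y where "Y = modified R T T' p"
    have Y_le: "Y n \<le> 1" for n using p by (simp add: Y_def modified_def)
    define Z where "Z = (\<lambda>n. Y n = 1)"
    have "{n. X n \<noteq> Z n} \<subseteq> {n. Y n \<noteq> p n}" unfolding X(1) Z_def by auto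
    moreover have "finite {n. Y n \<noteq> p n}"
      unfolding Y_def by (rule finite_modified[OF R assms(2) open_U stable])
    ultimately have "finite {n. X n \<noteq> Z n}" by (rule finite_subset)
    then have Z: "Z \<in> MLR" using X(2) by (rule MLR_finite_change)
    have "delta_MLR Y = Some Z" using Y_le Z unfolding Z_def by (simp add: delta_MLR_def)
    \<comment> \<open>\<open>Z\<close> is in the domain of \<open>LAY U\<close>, so the realizer has
      to answer on its name \<open>Y\<close>.\<close>
    moreover have "LAY U Z \<noteq> {}"
    proof -
      obtain i where "Z \<notin> U i" using Z test_U unfolding MLR_def by auto
      then show ?thesis using Z by (auto simp: LAY_def)
    qed
    ultimately obtain q j where q: "\<Gamma> Y = Some q" "delta_nat q = Some j" "j \<in> LAY U Z"
      using \<Gamma> unfolding realizes_def by blast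
    have q_eq: "q = (\<lambda>k. if k = j then 1 else 0)" using q(2) by (rule delta_nat_SomeD)
    have "Z \<notin> U j" using q(3) by (simp add: LAY_def split: if_splits)
    \<comment> \<open>Contrapositive of \<open>modified_mem\<close>: a change at some
      \<open>s \<ge> j\<close> would have put \<open>Z\<close> into \<open>U j\<close>.\<close>
    then have no_change: "\<not> changes T T' p s" if "j \<le> s" for s
      using modified_mem[of R U p T T' s j, OF R assms(2) open_U p _ that] unfolding Z_def Y_def by blast
    \<comment> \<open>The flag is constant from j on, and \<open>j + s0\<close> is a stage at which
      it is known to be correct; \<open>s0\<close> itself never has to be computed.\<close>
    have "flag T T' p (j + d) = flag T T' p j" for d
    proof (induction d)
      case (Suc d)
      then show ?case using no_change[of "j + d"] by (simp add: changes_def)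
    qed simp
    from this[of s0] flag[of "j + s0"] have flag_j: "flag T T' p j \<longleftrightarrow> X \<in> A" by simp
    have "\<Psi> (pair_seq p q) = Some (\<lambda>n. of_bool (n = of_bool (flag T T' (\<lambda>l. pair_seq p q (2 * l)) j)))"
      by (rule \<Psi>_eq) (simp_all add: pair_seq_def q_eq)
    also have "(\<lambda>l. pair_seq p q (2 * l)) = p" by (simp add: pair_seq_def)
    finally have "\<Psi> (pair_seq p q) = Some (\<lambda>k. if k = of_bool (X \<in> A) then 1 else 0)"
      unfolding flag_j of_bool_def .
    moreover have "of_bool (X \<in> A) \<in> chi_MLR A X" using X(2) by (simp add: chi_MLR_def)
    ultimately show "\<exists>r y. Option.bind (\<Phi> p) (\<lambda>q. Option.bind (\<Gamma> q) (\<lambda>r. \<Psi> (pair_seq p r))) = Some r \<and>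
        delta_nat r = Some y \<and> y \<in> chi_MLR A X"
      using q(1) delta_nat_indicator unfolding \<Phi>_def Y_def by auto
  qed
  with \<Phi> \<Psi> show ?thesis unfolding weihrauch_le_def by blast
qed

end
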